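(* There exists an orientation-preserving $C^\infty$ diffeomorphism $f:\mathbb{R}\to\mathbb{R}$, transcendental over $\mathbb{R}(x)$, such that for every real number field $K\subset\mathbb{R}$, every integer $n\geq 1$, and every integer $m\geq 0$, \[ D^m(f^{\circ n})(K)\subseteq K,\qquad D^m(f^{\circ n})(\mathscr{L})\subseteq\mathscr{L}. \] Moreover, such diffeomorphisms may be chosen arbitrarily close to the identity in the compact-open $C^\infty$ topology: for every neighborhood $\mathcal{U}$ of the identity map in $C^\infty(\mathbb{R})$ there is an orientation-preserving $C^\infty$ diffeomorphism $f:\mathbb{R}\to\mathbb{R}$ with $f\in\mathcal{U}$, transcendental over $\mathbb{R}(x)$, such that $D^m(f^{\circ n})(K)\subseteq K$ and $D^m(f^{\circ n})(\mathscr{L})\subseteq\mathscr{L}$ for every real number field $K\subset\mathbb{R}$, every integer $n\geq 1$, and every integer $m\geq 0$.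
   Context: A real number $\xi$ is a Liouville number if for every integer $N\geq1$ there are integers $p$ and $q\geq2$ with $0<|\xi-p/q|<q^{-N}$; $\mathscr{L}$ denotes the set of Liouville numbers. A real number field is a finite extension $K/\mathbb{Q}$ contained in $\mathbb{R}$. $D^m u$ is the $m$th derivative of $u$ ($D^0u=u$), $f^{\circ n}$ is the $n$th iterate of $f$, and for a function $u$ and a set $A$, $u(A)=\{u(x):x\in A\}$. A function $u:J\to\mathbb{R}$ is algebraic over $\mathbb{R}(x)$ if there is a nonzero $P\in\mathbb{R}[X,Y]$ with $P(x,u(x))=0$ for all $x\in J$; otherwise it is transcendental over $\mathbb{R}(x)$. The compact-open $C^\infty$ topology on $C^\infty(\mathbb{R})$ is the one generated by the seminorms $p_{A,r}(u)=\max_{0\le j\le r}\sup_{|x|\le A}|u^{(j)}(x)|$, $A,r\in\mathbb{N}$. *)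

theory Defs
  imports
    "HOL-Analysis.Analysis"
    "HOL-Computational_Algebra.Polynomial"
    "HOL-Algebra.Embedded_Algebras"
    "HOL-Algebra.Algebraic_Closure_Type"
begin

definition Liouville_numbers :: "real set" where
  "Liouville_numbers = {\<xi>. \<forall>N::nat\<ge>1. \<exists>p q::int. q \<ge> 2 \<and>
     0 < \<bar>\<xi> - of_int p / of_int q\<bar> \<and> \<bar>\<xi> - of_int p / of_int q\<bar> < 1 / of_int q ^ N}"

text \<open>The field of real numbers is \<^term>\<open>ring_of_type_algebra :: real ring\<close>; its subfields contain
  \<^term>\<open>\<rat>\<close> automatically, so no separate condition is needed for that.\<close>

definition real_number_field :: "real set \<Rightarrow> bool" where
  "real_number_field K \<longleftrightarrow> subfield K ring_of_type_algebra \<and>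
     ring.finite_dimension ring_of_type_algebra \<rat> K"

text \<open>The ring of polynomials in \<open>X\<close>, \<open>Y\<close> is encoded as \<^typ>\<open>real poly poly\<close>: the outer variable is
  \<open>Y\<close> and the coefficients are polynomials in \<open>X\<close>. Hence \<^term>\<open>poly (poly P [:y:]) x\<close> is
  the value of \<open>P\<close> at \<open>X = x\<close>, \<open>Y = y\<close>.\<close>

definition algebraic_over_Rx :: "real set \<Rightarrow> (real \<Rightarrow> real) \<Rightarrow> bool" where
  "algebraic_over_Rx J u \<longleftrightarrow>
     (\<exists>P :: real poly poly. P \<noteq> 0 \<and> (\<forall>x\<in>J. poly (poly P [:u x:]) x = 0))"

definition transcendental_over_Rx :: "real set \<Rightarrow> (real \<Rightarrow> real) \<Rightarrow> bool" where
  "transcendental_over_Rx J u \<longleftrightarrow> \<not> algebraic_over_Rx J u"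

definition smooth :: "(real \<Rightarrow> real) \<Rightarrow> bool" where
  "smooth u \<longleftrightarrow> (\<forall>k. (deriv ^^ k) u differentiable_on UNIV)"

definition smooth_diffeomorphism :: "(real \<Rightarrow> real) \<Rightarrow> bool" where
  "smooth_diffeomorphism f \<longleftrightarrow> bij f \<and> smooth f \<and> smooth (inv_into UNIV f)"

definition orientation_preserving :: "(real \<Rightarrow> real) \<Rightarrow> bool" where
  "orientation_preserving f \<longleftrightarrow> (\<forall>x. deriv f x > 0)"

definition Cinf_seminorm :: "nat \<Rightarrow> nat \<Rightarrow> (real \<Rightarrow> real) \<Rightarrow> real" where
  "Cinf_seminorm A r u =
     Max ((\<lambda>j. SUP x\<in>{x. \<bar>x\<bar> \<le> real A}. \<bar>(deriv ^^ j) u x\<bar>) ` {0..r})"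

text \<open>The topology generated by the seminorms, on the carrier of all smooth functions: the
  seminorm balls with arbitrary smooth centres form a subbasis.\<close>

definition Cinf_topology :: "(real \<Rightarrow> real) topology" where
  "Cinf_topology = topology_generated_by
     {{v. smooth v \<and> Cinf_seminorm A r (\<lambda>x. v x - u x) < e} | A r u e. smooth u \<and> e > 0}"

lemma topspace_Cinf_topology: "topspace Cinf_topology = {u. smooth u}"
proof
  have d0: "(deriv ^^ j) (\<lambda>x. 0) = (\<lambda>x. 0 :: real)" for j
    by (induction j) simp_all
  have "{x. \<bar>x\<bar> \<le> real 0} \<noteq> {}"
    by auto
  then have z: "Cinf_seminorm 0 0 (\<lambda>x. u x - u x) < 1" for u
    by (simp add: Cinf_seminorm_def d0)
  show "{u. smooth u} \<subseteq> topspace Cinf_topology"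
  proof
    fix u :: "real \<Rightarrow> real"
    assume "u \<in> {u. smooth u}"
    then have u: "smooth u" by simp
    have "u \<in> {v. smooth v \<and> Cinf_seminorm 0 0 (\<lambda>x. v x - u x) < 1}"
      using u z by simp
    moreover have "\<exists>A r u' e. {v. smooth v \<and> Cinf_seminorm 0 0 (\<lambda>x. v x - u x) < 1} =
        {v. smooth v \<and> Cinf_seminorm A r (\<lambda>x. v x - u' x) < e} \<and> smooth u' \<and> e > 0"
      using u zero_less_one by blast
    ultimately show "u \<in> topspace Cinf_topology"
      unfolding Cinf_topology_def topology_generated_by_topspace by blast
  qed
  show "topspace Cinf_topology \<subseteq> {u. smooth u}"
    unfolding Cinf_topology_def topology_generated_by_topspace by auto
qed

end

theory Submission
  imports Defs
begin

text \<open>The Liouville numbers and the algebraic numbers together form a null set, so they are covered by an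
  open set whose complement contains a nonempty perfect set \<open>P\<close> inside \<open>[0,1]\<close>. The gaps of \<open>P\<close> are
  infinitely many open intervals with pairwise disjoint closures. The map \<open>f\<close> is built so that on each
  gap, and also outside the convex hull of \<open>P\<close>, it coincides with a function \<open>T(x) + c / (1 + x\<^sup>2)\<close>, where \<open>T\<close> is
  a nonconstant polynomial over \<open>\<rat>\<close> and \<open>c \<noteq> 0\<close> is rational: starting from \<open>x + c\<^sub>0 / (1 + x\<^sup>2)\<close>, the
  gaps are treated one after another, each time adding a smooth correction supported away from the earlier
  gaps; it can be taken arbitrarily small by the Weierstrass theorem in \<open>C\<^sup>n\<close>.

  Near a Liouville or algebraic point every iterate of \<open>f\<close> is then a composition of such functions, hence
  a rational function over \<open>\<rat>\<close> with poles at \<open>\<plusminus>\<i>\<close> and no real poles. It is not a polynomial, so none of its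
  derivatives is constant; and a nonconstant rational function over \<open>\<rat>\<close> maps Liouville numbers to
  Liouville numbers (Maillet) and every number field into itself. Since the coefficients \<open>c\<close> on the
  gaps are pairwise distinct, \<open>f\<close> agrees on intervals with infinitely many rational functions and so
  satisfies no polynomial equation over \<open>\<real>(x)\<close>.\<close>

subsection \<open>Smooth functions\<close>

lemma smooth_iff: "smooth u \<longleftrightarrow> (\<forall>k x. (deriv ^^ k) u differentiable at x)"
  by (auto simp: smooth_def differentiable_on_def)

text \<open>Induction keeps every iterated derivative of \<open>u\<close> inside \<open>S\<close>,
  where differentiability is assumed. Used with sets given by a formula: flat functions, smooth
  functions of an inverse, termwise differentiated series.\<close>

lemma smoothI_class:
  assumes "u \<in> S" and "\<And>v. v \<in> S \<Longrightarrow> \<exists>v'\<in>S. \<forall>x. (v has_real_derivative v' x) (at x)"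
  shows "smooth u"
proof -
  have "(deriv ^^ k) u \<in> S" for k
  proof (induction k)
    case (Suc k)
    then obtain v' where v': "v' \<in> S" "\<forall>x. ((deriv ^^ k) u has_real_derivative v' x) (at x)"
      using assms(2) by blast
    then have "(deriv ^^ Suc k) u = v'" by (auto intro: DERIV_imp_deriv)
    with v' show ?case by simp
  qed (use assms in simp)
  then show ?thesis unfolding smooth_iff
    using assms(2) real_differentiable_def by blast
qed

lemma smooth_deriv: "smooth u \<Longrightarrow> smooth (deriv u)"
  unfolding smooth_iff by (metis comp_apply funpow_Suc_right)

lemma smooth_funpow_deriv: "smooth u \<Longrightarrow> smooth ((deriv ^^ k) u)"
  by (induction k) (auto intro: smooth_deriv)

lemma smooth_DERIV: "smooth u \<Longrightarrow> (u has_real_derivative deriv u x) (at x)"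
  unfolding smooth_iff using DERIV_deriv_iff_real_differentiable by (metis funpow_0)

lemma smooth_funpow_DERIV:
  "smooth u \<Longrightarrow> ((deriv ^^ k) u has_real_derivative (deriv ^^ Suc k) u x) (at x)"
  using smooth_DERIV[OF smooth_funpow_deriv, of u k x] by simp

lemma smooth_continuous_on: "smooth u \<Longrightarrow> continuous_on A u"
  by (meson DERIV_continuous_on has_field_derivative_at_within smooth_DERIV)

lemma smooth_funpow_continuous_on: "smooth u \<Longrightarrow> continuous_on A ((deriv ^^ k) u)"
  by (intro smooth_continuous_on smooth_funpow_deriv)

text \<open>Finite orders of differentiability, peeling derivatives off from the inside, so that closure under
  products, quotients and composition goes through by induction on the order.\<close>

primrec times_diff :: "nat \<Rightarrow> (real \<Rightarrow> real) \<Rightarrow> bool" where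
  "times_diff 0 u \<longleftrightarrow> (\<forall>x. u differentiable at x)"
| "times_diff (Suc n) u \<longleftrightarrow> (\<forall>x. u differentiable at x) \<and> times_diff n (deriv u)"

lemma smooth_iff_times_diff: "smooth u \<longleftrightarrow> (\<forall>n. times_diff n u)"
proof
  show "smooth u \<Longrightarrow> \<forall>n. times_diff n u"
  proof
    fix n assume "smooth u" then show "times_diff n u"
    proof (induction n arbitrary: u)
      case 0 then show ?case using smooth_DERIV real_differentiable_def by auto
    next
      case (Suc n) then show ?case using smooth_DERIV real_differentiable_def smooth_deriv by auto
    qed
  qed
  have "times_diff n u \<Longrightarrow> (deriv ^^ n) u differentiable at x" for n u x
    by (induction n arbitrary: u) (auto simp: funpow_Suc_right simp del: funpow.simps)
  then show "\<forall>n. times_diff n u \<Longrightarrow> smooth u" unfolding smooth_iff by blast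
qed

lemma times_diff_SucD: "times_diff (Suc n) u \<Longrightarrow> times_diff n u"
  by (induction n arbitrary: u) auto

lemma times_diff_differentiable: "times_diff n u \<Longrightarrow> u differentiable at x"
  by (cases n) auto

lemma times_diff_DERIV: "times_diff n u \<Longrightarrow> (u has_real_derivative deriv u x) (at x)"
  using times_diff_differentiable DERIV_deriv_iff_real_differentiable by blast

lemma times_diff_SucI:
  assumes "\<And>x. (u has_real_derivative u' x) (at x)" "times_diff n u'"
  shows "times_diff (Suc n) u"
proof -
  have "deriv u = u'" using assms(1) by (auto intro: DERIV_imp_deriv)
  with assms show ?thesis using real_differentiable_def by auto
qed

lemma times_diff_add: "times_diff n u \<Longrightarrow> times_diff n v \<Longrightarrow> times_diff n (\<lambda>x. u x + v x)"
proof (induction n arbitrary: u v)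
  case (Suc n)
  show ?case
    by (rule times_diff_SucI[where u' = "\<lambda>x. deriv u x + deriv v x"])
      (use Suc in \<open>auto intro!: DERIV_add times_diff_DERIV[OF Suc.prems(1)] times_diff_DERIV[OF Suc.prems(2)]\<close>)
qed (auto intro: derivative_intros)

lemma times_diff_mult: "times_diff n u \<Longrightarrow> times_diff n v \<Longrightarrow> times_diff n (\<lambda>x. u x * v x)"
proof (induction n arbitrary: u v)
  case (Suc n)
  show ?case
  proof (rule times_diff_SucI[where u' = "\<lambda>x. deriv u x * v x + deriv v x * u x"])
    show "((\<lambda>x. u x * v x) has_real_derivative deriv u x * v x + deriv v x * u x) (at x)" for x
      by (intro DERIV_mult times_diff_DERIV[OF Suc.prems(1)] times_diff_DERIV[OF Suc.prems(2)])
    show "times_diff n (\<lambda>x. deriv u x * v x + deriv v x * u x)"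
      by (intro times_diff_add Suc.IH) (use Suc.prems times_diff_SucD in auto)
  qed
qed (auto intro: derivative_intros)

lemma times_diff_const: "times_diff n (\<lambda>x. c)"
proof (induction n arbitrary: c)
  case (Suc n)
  show ?case by (rule times_diff_SucI[where u' = "\<lambda>x. 0"]) (use Suc in auto)
qed auto

lemma times_diff_inverse:
  assumes "\<And>x. u x \<noteq> 0"
  shows "times_diff n u \<Longrightarrow> times_diff n (\<lambda>x. inverse (u x))"
proof (induction n)
  case (Suc n)
  show ?case
  proof (rule times_diff_SucI[where u' = "\<lambda>x. (-1) * (inverse (u x) * deriv u x * inverse (u x))"])
    show "((\<lambda>x. inverse (u x)) has_real_derivative (-1) * (inverse (u x) * deriv u x * inverse (u x))) (at x)" for x
      using DERIV_inverse'[OF times_diff_DERIV[OF Suc.prems] assms] by simp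
    show "times_diff n (\<lambda>x. (-1) * (inverse (u x) * deriv u x * inverse (u x)))"
      by (intro times_diff_mult Suc.IH times_diff_const) (use Suc.prems times_diff_SucD in auto)
  qed
qed (use assms in \<open>auto intro: derivative_intros\<close>)

lemma times_diff_compose:
  "times_diff n u \<Longrightarrow> times_diff n v \<Longrightarrow> times_diff n (\<lambda>x. u (v x))"
proof (induction n arbitrary: u)
  case (Suc n)
  show ?case
  proof (rule times_diff_SucI[where u' = "\<lambda>x. deriv u (v x) * deriv v x"])
    show "((\<lambda>x. u (v x)) has_real_derivative deriv u (v x) * deriv v x) (at x)" for x
      by (rule DERIV_chain2[OF times_diff_DERIV[OF Suc.prems(1)] times_diff_DERIV[OF Suc.prems(2)]])
    show "times_diff n (\<lambda>x. deriv u (v x) * deriv v x)"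
      using Suc.prems times_diff_SucD[OF Suc.prems(2)]
      by (intro times_diff_mult Suc.IH[of "deriv u"]) auto
  qed
next
  case 0
  have "((\<lambda>x. u (v x)) has_real_derivative deriv u (v x) * deriv v x) (at x)" for x
    by (rule DERIV_chain2[OF times_diff_DERIV[OF 0(1)] times_diff_DERIV[OF 0(2)]])
  then show ?case by (auto simp: real_differentiable_def)
qed

lemma smooth_add: "smooth u \<Longrightarrow> smooth v \<Longrightarrow> smooth (\<lambda>x. u x + v x)"
  by (simp add: smooth_iff_times_diff times_diff_add)

lemma smooth_mult: "smooth u \<Longrightarrow> smooth v \<Longrightarrow> smooth (\<lambda>x. u x * v x)"
  by (simp add: smooth_iff_times_diff times_diff_mult)

lemma smooth_const: "smooth (\<lambda>x. c)"
  by (simp add: smooth_iff_times_diff times_diff_const)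

lemma smooth_inverse: "(\<And>x. u x \<noteq> 0) \<Longrightarrow> smooth u \<Longrightarrow> smooth (\<lambda>x. inverse (u x))"
  by (simp add: smooth_iff_times_diff times_diff_inverse)

lemma smooth_compose: "smooth u \<Longrightarrow> smooth v \<Longrightarrow> smooth (\<lambda>x. u (v x))"
  by (simp add: smooth_iff_times_diff times_diff_compose)

lemma smooth_ident: "smooth (\<lambda>x. x)"
proof -
  have "times_diff n (\<lambda>x. x)" for n
    by (rule times_diff_SucD, rule times_diff_SucI[where u' = "\<lambda>x. 1"]) (auto intro: times_diff_const)
  then show ?thesis by (simp add: smooth_iff_times_diff)
qed

lemma smooth_diff: "smooth u \<Longrightarrow> smooth v \<Longrightarrow> smooth (\<lambda>x. u x - v x)"
  using smooth_add[of u "\<lambda>x. (-1) * v x"] smooth_mult[of "\<lambda>x. -1" v] smooth_const by auto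

lemma smooth_divide:
  "(\<And>x. v x \<noteq> 0) \<Longrightarrow> smooth u \<Longrightarrow> smooth v \<Longrightarrow> smooth (\<lambda>x. u x / v x)"
  unfolding divide_inverse by (intro smooth_mult smooth_inverse)

lemma smooth_poly: "smooth (poly p)"
proof (induction p)
  case 0 have "poly 0 = (\<lambda>x. 0 :: real)" by auto
  then show ?case using smooth_const[of 0] by simp
next
  case (pCons a p)
  have "poly (pCons a p) = (\<lambda>x. a + x * poly p x)" by auto
  moreover have "smooth (\<lambda>x. a + x * poly p x)"
    by (intro smooth_add smooth_mult smooth_const smooth_ident pCons.IH)
  ultimately show ?case by simp
qed

lemma funpow_deriv_add:
  assumes "smooth u" "smooth v"
  shows "(deriv ^^ k) (\<lambda>x. u x + v x) = (\<lambda>x. (deriv ^^ k) u x + (deriv ^^ k) v x)"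
proof (induction k)
  case (Suc k)
  have "((\<lambda>x. (deriv ^^ k) u x + (deriv ^^ k) v x) has_real_derivative
      (deriv ^^ Suc k) u x + (deriv ^^ Suc k) v x) (at x)" for x
    by (intro DERIV_add smooth_funpow_DERIV assms)
  then show ?case using Suc by (auto intro!: ext DERIV_imp_deriv)
qed simp

lemma funpow_deriv_const0: "(deriv ^^ k) (\<lambda>x. 0) = (\<lambda>x. 0 :: real)"
  by (induction k) auto

text \<open>Every derivative of the inverse \<open>g\<close> has the form \<open>h \<circ> g\<close> with \<open>h\<close> smooth, because
  \<open>(h \<circ> g)' = (h' / f') \<circ> g\<close>.\<close>

lemma smooth_inv:
  assumes f: "smooth f" "bij f" "\<And>x. deriv f x > 0"
  shows "smooth (inv_into UNIV f)"
proof (rule smoothI_class[where S = "{\<lambda>y. h (inv_into UNIV f y) | h. smooth h}"])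
  have fi: "f (inv_into UNIV f y) = y" for y using f(2) by (simp add: bij_is_surj surj_f_inv_f)
  have ci: "isCont (inv_into UNIV f) y" for y
  proof -
    have "isCont (inv_into UNIV f) (f (inv_into UNIV f y))"
      by (rule isCont_inverse_function[where d = 1])
        (use f smooth_continuous_on[of f UNIV] in \<open>auto simp: bij_is_inj continuous_on_eq_continuous_at\<close>)
    then show ?thesis by (simp add: fi)
  qed
  have di: "(inv_into UNIV f has_real_derivative inverse (deriv f (inv_into UNIV f y))) (at y)" for y
    by (rule DERIV_inverse_function[where f = f and a = "y - 1" and b = "y + 1"])
      (use f(3)[of "inv_into UNIV f y"] smooth_DERIV[OF f(1)] ci fi in auto)
  show "inv_into UNIV f \<in> {\<lambda>y. h (inv_into UNIV f y) | h. smooth h}"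
    using smooth_ident by fastforce
  fix v assume "v \<in> {\<lambda>y. h (inv_into UNIV f y) | h. smooth h}"
  then obtain h where h: "smooth h" "v = (\<lambda>y. h (inv_into UNIV f y))" by auto
  let ?h = "\<lambda>x. deriv h x / deriv f x"
  have "smooth ?h" by (intro smooth_divide smooth_deriv f h) (metis f(3) less_irrefl)
  moreover have "(v has_real_derivative ?h (inv_into UNIV f y)) (at y)" for y
    using DERIV_chain2[OF smooth_DERIV[OF h(1)] di, of y] h(2) by (simp add: divide_inverse)
  ultimately show "\<exists>v'\<in>{\<lambda>y. h (inv_into UNIV f y) | h. smooth h}. \<forall>x. (v has_real_derivative v' x) (at x)"
    by (intro bexI[of _ "\<lambda>y. ?h (inv_into UNIV f y)"]) auto
qed

subsection \<open>Bump functions, approximation and series\<close>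

lemma poly_times_exp_minus_tendsto_0: "((\<lambda>y. poly p y * exp (- y)) \<longlongrightarrow> (0::real)) at_top"
proof -
  have "((\<lambda>y. \<Sum>i\<le>Polynomial.degree p. Polynomial.coeff p i * (y ^ i / exp y)) \<longlongrightarrow>
      (\<Sum>i\<le>Polynomial.degree p. Polynomial.coeff p i * 0)) at_top"
    by (intro tendsto_intros tendsto_power_div_exp_0)
  then show ?thesis
    by (simp add: poly_altdef exp_minus divide_inverse sum_distrib_right mult.assoc)
qed

text \<open>The polynomial in 1/x makes the family stable under differentiation: with y = 1/x, the
  derivative of p(y) exp(-y) is y^2 (p - p')(y) exp(-y). The member with p = 1 is the classical flat
  function exp(-1/x).\<close>

definition flat_fun :: "real poly \<Rightarrow> real \<Rightarrow> real" where
  "flat_fun p x = (if x > 0 then poly p (inverse x) * exp (- inverse x) else 0)"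

lemma flat_fun_DERIV: "(flat_fun p has_real_derivative flat_fun ([:0, 0, 1:] * (p - pderiv p)) x) (at x)"
proof -
  let ?q = "[:0, 0, 1:] * (p - pderiv p)"
  consider "x > 0" | "x < 0" | "x = 0" by linarith
  then show ?thesis
  proof cases
    case 1
    have "((\<lambda>x. poly p (inverse x) * exp (- inverse x)) has_real_derivative
        poly (pderiv p) (inverse x) * (- (inverse x * 1 * inverse x)) * exp (- inverse x)
        + exp (- inverse x) * (- (- (inverse x * 1 * inverse x))) * poly p (inverse x)) (at x)"
      using 1 by (intro DERIV_mult DERIV_chain2[OF poly_DERIV] DERIV_fun_exp DERIV_minus DERIV_inverse' DERIV_ident) auto
    then have "((\<lambda>x. poly p (inverse x) * exp (- inverse x)) has_real_derivative flat_fun ?q x) (at x)"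
      by (rule DERIV_cong) (use 1 in \<open>simp add: flat_fun_def algebra_simps\<close>)
    moreover have "eventually (\<lambda>y. flat_fun p y = poly p (inverse y) * exp (- inverse y)) (nhds x)"
      using eventually_nhds_in_open[of "{0<..}" x] 1 by (auto elim!: eventually_mono simp: flat_fun_def)
    ultimately show ?thesis by (simp add: DERIV_cong_ev)
  next
    case 2
    have "eventually (\<lambda>y. flat_fun p y = 0) (nhds x)"
      using eventually_nhds_in_open[of "{..<0}" x] 2 by (auto elim!: eventually_mono simp: flat_fun_def)
    then have "(flat_fun p has_real_derivative 0) (at x)"
      by (subst DERIV_cong_ev[OF refl _ refl]) auto
    with 2 show ?thesis by (simp add: flat_fun_def)
  next
    case 3
    \<comment> \<open>With y = 1/x the right-hand difference quotient at 0 is y p(y) exp(-y); the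
      extra factor y is the shift \<open>pCons 0 p\<close>.\<close>
    have "((\<lambda>y. poly (pCons 0 p) y * exp (- y)) \<longlongrightarrow> (0::real)) at_top"
      by (rule poly_times_exp_minus_tendsto_0)
    from filterlim_compose[OF this filterlim_inverse_at_top_right]
    have "((\<lambda>x. flat_fun p x / x) \<longlongrightarrow> 0) (at_right 0)"
      by (rule filterlim_cong[THEN iffD1, rotated -1])
        (auto simp: flat_fun_def eventually_at_filter field_simps)
    moreover have "((\<lambda>x. flat_fun p x / x) \<longlongrightarrow> 0) (at_left 0)"
      by (rule tendsto_eventually) (auto simp: flat_fun_def eventually_at_filter)
    ultimately have "((\<lambda>x. flat_fun p x / x) \<longlongrightarrow> 0) (at 0)"
      by (simp add: filterlim_split_at)
    then show ?thesis using 3 by (simp add: has_field_derivative_iff flat_fun_def)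
  qed
qed

lemma smooth_flat_fun: "smooth (flat_fun p)"
  by (rule smoothI_class[where S = "range flat_fun"]) (use flat_fun_DERIV in auto)

text \<open>The witness is h(x) / (h(x) + h(1 - x)) with h(x) = exp(-1/x) for x > 0 and 0 otherwise.
  The denominator is positive because x or 1 - x is.\<close>

lemma smooth_step_exists:
  obtains s where "smooth s" "\<And>x. x \<le> 0 \<Longrightarrow> s x = 0" "\<And>x. x \<ge> 1 \<Longrightarrow> s x = 1"
proof -
  let ?h = "flat_fun 1"
  have pos: "?h x + ?h (1 - x) > 0" for x
    by (cases "x > 0"; cases "x < 1") (auto simp: flat_fun_def intro: add_pos_pos)
  show ?thesis
  proof
    show "smooth (\<lambda>x. ?h x / (?h x + ?h (1 - x)))"
      using pos by (intro smooth_divide smooth_add smooth_flat_fun smooth_compose[of ?h "\<lambda>x. 1 - x"]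
          smooth_diff smooth_const smooth_ident) (metis less_irrefl)
    show "?h x / (?h x + ?h (1 - x)) = 0" if "x \<le> 0" for x
      using that by (simp add: flat_fun_def)
    show "?h x / (?h x + ?h (1 - x)) = 1" if "x \<ge> 1" for x
      using that by (simp add: flat_fun_def)
  qed
qed

lemma smooth_bump_exists:
  fixes a b c d :: real
  assumes "a < b" "c < d"
  obtains w where "smooth w" "\<And>x. b \<le> x \<Longrightarrow> x \<le> c \<Longrightarrow> w x = 1"
    "\<And>x. x \<notin> {a..d} \<Longrightarrow> w x = 0"
proof -
  obtain s where s: "smooth s" "\<And>x. x \<le> 0 \<Longrightarrow> s x = 0" "\<And>x. x \<ge> 1 \<Longrightarrow> s x = 1"
    using smooth_step_exists by blast
  show ?thesis
  proof
    show "smooth (\<lambda>x. s ((x - a) / (b - a)) * s ((d - x) / (d - c)))"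
      by (intro smooth_mult smooth_compose[of s "\<lambda>x. (x - a) / (b - a)"] s(1)
          smooth_compose[of s "\<lambda>x. (d - x) / (d - c)"] smooth_divide smooth_diff smooth_const smooth_ident)
        (use assms in auto)
    show "s ((x - a) / (b - a)) * s ((d - x) / (d - c)) = 1" if "b \<le> x" "x \<le> c" for x
      using that assms by (simp add: s)
    show "s ((x - a) / (b - a)) * s ((d - x) / (d - c)) = 0" if "x \<notin> {a..d}" for x
      using that assms by (cases "x < a") (auto simp: s divide_le_0_iff)
  qed
qed

section \<open>Estimates and approximation for several derivatives at once\<close>

lemma deriv_mult_smooth:
  assumes "smooth u" "smooth v"
  shows "deriv (\<lambda>x. u x * v x) = (\<lambda>x. deriv u x * v x + u x * deriv v x)"
  by (intro ext DERIV_imp_deriv)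
    (use DERIV_mult[OF smooth_DERIV[OF assms(1)] smooth_DERIV[OF assms(2)]] in \<open>simp add: mult.commute\<close>)

text \<open>Multiplication by a fixed smooth \<open>w\<close> is continuous in the C^n norm of a
  compact interval. The induction uses (wu)' = w'u + wu' and asks for \<open>e / 2\<close> from each
  summand, so \<open>w\<close> and \<open>e\<close> must stay general: the hypothesis is applied to
  both \<open>deriv w\<close> and \<open>w\<close>.\<close>

lemma smooth_mult_small:
  fixes a b e :: real
  assumes "smooth w" "e > 0"
  shows "\<exists>\<delta>>0. \<forall>u. smooth u \<and> (\<forall>j\<le>n. \<forall>x\<in>{a..b}. \<bar>(deriv ^^ j) u x\<bar> \<le> \<delta>) \<longrightarrow>
    (\<forall>j\<le>n. \<forall>x\<in>{a..b}. \<bar>(deriv ^^ j) (\<lambda>x. w x * u x) x\<bar> \<le> e)"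
  using assms
proof (induction n arbitrary: w e)
  case 0
  have "bounded (w ` {a..b})"
    by (intro compact_imp_bounded compact_continuous_image smooth_continuous_on 0 compact_Icc)
  then obtain M where M: "M > 0" "\<And>x. x \<in> {a..b} \<Longrightarrow> \<bar>w x\<bar> \<le> M"
    unfolding bounded_pos by auto
  have "\<bar>w x * u\<bar> \<le> e" if "\<bar>u\<bar> \<le> e / M" "x \<in> {a..b}" for u x
  proof -
    have "\<bar>w x * u\<bar> \<le> M * (e / M)" unfolding abs_mult by (intro mult_mono M that) (use M in auto)
    with M show ?thesis by simp
  qed
  with M 0 show ?case by (intro exI[of _ "e / M"]) auto
next
  case (Suc n)
  have "smooth (deriv w)" "e / 2 > 0" using Suc.prems smooth_deriv by auto
  note * = this
  obtain d1 where d1: "d1 > 0" "\<And>u j x. smooth u \<Longrightarrow> (\<forall>j\<le>n. \<forall>x\<in>{a..b}. \<bar>(deriv ^^ j) u x\<bar> \<le> d1) \<Longrightarrow> j \<le> n \<Longrightarrow> x \<in> {a..b}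
      \<Longrightarrow> \<bar>(deriv ^^ j) (\<lambda>x. deriv w x * u x) x\<bar> \<le> e / 2"
    using Suc.IH[OF *] by blast
  obtain d2 where d2: "d2 > 0" "\<And>u j x. smooth u \<Longrightarrow> (\<forall>j\<le>n. \<forall>x\<in>{a..b}. \<bar>(deriv ^^ j) u x\<bar> \<le> d2) \<Longrightarrow> j \<le> n \<Longrightarrow> x \<in> {a..b}
      \<Longrightarrow> \<bar>(deriv ^^ j) (\<lambda>x. w x * u x) x\<bar> \<le> e / 2"
    using Suc.IH[OF Suc.prems(1) *(2)] by blast
  note d = d1 d2
  show ?case
  proof (intro exI[of _ "min d1 d2"] conjI allI impI ballI, goal_cases)
    case 1 with d show ?case by simp
  next
    case (2 u j x)
    then have u: "smooth u" "\<And>j x. j \<le> Suc n \<Longrightarrow> x \<in> {a..b} \<Longrightarrow> \<bar>(deriv ^^ j) u x\<bar> \<le> min d1 d2" by auto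
    have u': "\<bar>(deriv ^^ j) (deriv u) x\<bar> \<le> min d1 d2" if "j \<le> n" "x \<in> {a..b}" for j x
      using u(2)[of "Suc j" x] that by (simp add: funpow_Suc_right del: funpow.simps)
    show ?case
    proof (cases j)
      case 0
      have "\<bar>w x * u x\<bar> \<le> e / 2"
        using d(4)[of u 0 x] u 2 by auto
      with 0 Suc.prems show ?thesis by simp
    next
      case (Suc i)
      have "(deriv ^^ j) (\<lambda>x. w x * u x) = (deriv ^^ i) (\<lambda>x. deriv w x * u x + w x * deriv u x)"
        using deriv_mult_smooth[OF Suc.prems(1) u(1)] Suc by (simp add: funpow_Suc_right del: funpow.simps)
      also have "\<dots> = (\<lambda>x. (deriv ^^ i) (\<lambda>x. deriv w x * u x) x + (deriv ^^ i) (\<lambda>x. w x * deriv u x) x)"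
        by (intro funpow_deriv_add smooth_mult smooth_deriv Suc.prems u)
      finally have eq: "(deriv ^^ j) (\<lambda>x. w x * u x) x =
          (deriv ^^ i) (\<lambda>x. deriv w x * u x) x + (deriv ^^ i) (\<lambda>x. w x * deriv u x) x" by simp
      have "\<bar>(deriv ^^ i) (\<lambda>x. deriv w x * u x) x\<bar> \<le> e / 2"
        using u 2 Suc by (intro d(2)) auto
      moreover have "\<bar>(deriv ^^ i) (\<lambda>x. w x * deriv u x) x\<bar> \<le> e / 2"
        using u' 2 Suc by (intro d(4) smooth_deriv u(1)) auto
      ultimately show ?thesis unfolding eq by linarith
    qed
  qed
qed

definition rat_poly :: "real poly \<Rightarrow> bool" where
  "rat_poly p \<longleftrightarrow> (\<forall>i. Polynomial.coeff p i \<in> \<rat>)"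

lemma rat_approx:
  fixes x e :: real assumes "e > 0" obtains q where "q \<in> \<rat>" "\<bar>x - q\<bar> < e"
proof -
  have "x < x + e" using assms by simp
  from Rats_dense_in_real[OF this] obtain q where "q \<in> \<rat>" "x < q" "q < x + e" by blast
  then show ?thesis by (intro that[of q]) auto
qed

lemma rat_poly_approx_real_poly:
  fixes a b e :: real
  assumes "e > 0"
  shows "\<exists>q. rat_poly q \<and> (\<forall>x\<in>{a..b}. \<bar>(\<Sum>i\<le>n. c i * x ^ i) - poly q x\<bar> \<le> e)"
proof -
  \<comment> \<open>The lower bound 1 gives |x|^i <= M^n for all i <= n, so rounding each of the n +
    1 coefficients by at most \<open>d\<close> costs at most e in total.\<close>
  define M where "M = max 1 (max \<bar>a\<bar> \<bar>b\<bar>)"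
  have M: "M \<ge> 1" "\<And>x. x \<in> {a..b} \<Longrightarrow> \<bar>x\<bar> \<le> M" by (auto simp: M_def)
  define d where "d = e / (real (Suc n) * M ^ n)"
  have d: "d > 0" using M assms by (simp add: d_def)
  have "\<exists>r. \<forall>i. r i \<in> \<rat> \<and> \<bar>c i - r i\<bar> < d"
    by (rule choice) (metis rat_approx[OF d])
  then obtain r where r: "\<And>i. r i \<in> \<rat>" "\<And>i. \<bar>c i - r i\<bar> < d" by blast
  define q where "q = (\<Sum>i\<le>n. Polynomial.monom (r i) i)"
  have "rat_poly q"
    unfolding q_def by (auto simp: rat_poly_def Polynomial.coeff_sum intro!: Rats_sum r)
  moreover have "\<bar>(\<Sum>i\<le>n. c i * x ^ i) - poly q x\<bar> \<le> e" if x: "x \<in> {a..b}" for x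
  proof -
    have "(\<Sum>i\<le>n. c i * x ^ i) - poly q x = (\<Sum>i\<le>n. (c i - r i) * x ^ i)"
      by (simp add: q_def poly_sum poly_monom sum_subtractf[symmetric] algebra_simps)
    also have "\<bar>\<dots>\<bar> \<le> (\<Sum>i\<le>n. \<bar>(c i - r i) * x ^ i\<bar>)" by (rule sum_abs)
    also have "\<dots> \<le> (\<Sum>i\<le>n. d * M ^ n)"
    proof (rule sum_mono)
      fix i assume "i \<in> {..n}"
      then have "\<bar>x\<bar> ^ i \<le> M ^ n"
        using M(1) M(2)[OF x] by (metis abs_ge_zero atMost_iff order_trans power_increasing power_mono)
      then show "\<bar>(c i - r i) * x ^ i\<bar> \<le> d * M ^ n"
        unfolding abs_mult power_abs using r(2)[of i] by (intro mult_mono) auto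
    qed
    also have "\<dots> = e" using M(1) by (simp add: d_def)
    finally show ?thesis .
  qed
  ultimately show ?thesis by blast
qed

definition poly_integral :: "real poly \<Rightarrow> real poly" where
  "poly_integral p = (\<Sum>i\<le>Polynomial.degree p. Polynomial.monom (Polynomial.coeff p i / real (Suc i)) (Suc i))"

lemma rat_poly_integral: "rat_poly p \<Longrightarrow> rat_poly (poly_integral p)"
  by (auto simp: poly_integral_def rat_poly_def Polynomial.coeff_sum intro!: Rats_sum Rats_divide)

lemma pderiv_poly_integral: "pderiv (poly_integral p) = p"
  by (rule poly_eqI)
    (auto simp: poly_integral_def coeff_pderiv Polynomial.coeff_sum Polynomial.coeff_eq_0 simp del: of_nat_Suc)

text \<open>Approximate u' to order n by induction, integrate the resulting polynomial, and round
  the constant of integration to a rational. Integration keeps the coefficients rational.\<close>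

lemma Weierstrass_smooth_rat:
  fixes a b e :: real
  assumes "smooth u" "e > 0" "a \<le> b"
  shows "\<exists>p. rat_poly p \<and> (\<forall>j\<le>n. \<forall>x\<in>{a..b}. \<bar>(deriv ^^ j) (\<lambda>x. poly p x - u x) x\<bar> \<le> e)"
  using assms
proof (induction n arbitrary: u e)
  case 0
  obtain g where g: "real_polynomial_function g" "\<And>x. x \<in> {a..b} \<Longrightarrow> \<bar>u x - g x\<bar> < e / 2"
    using Stone_Weierstrass_real_polynomial_function[OF compact_Icc smooth_continuous_on[OF 0(1)], of "e/2" a b] 0
    by auto
  then obtain c n where gc: "g = (\<lambda>x. \<Sum>i\<le>n. c i * x ^ i)"
    using real_polynomial_function_iff_sum by blast
  obtain q where q: "rat_poly q" "\<And>x. x \<in> {a..b} \<Longrightarrow> \<bar>g x - poly q x\<bar> \<le> e / 2"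
    using rat_poly_approx_real_poly[of "e/2" a b c n] 0 gc by auto
  have "\<bar>poly q x - u x\<bar> \<le> e" if "x \<in> {a..b}" for x
    using g(2)[OF that] q(2)[OF that] by linarith
  with q show ?case by auto
next
  case (Suc n)
  \<comment> \<open>An error \<open>d\<close> in the derivative accumulates to at most d (b - a) <=
    e/2 over the interval, leaving e/2 for the rounded constant; \<open>d \<le> e\<close> serves the
    higher derivatives. The added 1 keeps the denominator positive when a = b.\<close>
  define d where "d = min e (e / (2 * (b - a + 1)))"
  have d: "d > 0" "d \<le> e" "d * (b - a) \<le> e / 2"
  proof -
    show "d > 0" "d \<le> e" using Suc.prems by (auto simp: d_def)
    have "d * (b - a) \<le> e / (2 * (b - a + 1)) * (b - a + 1)"
      using Suc.prems by (intro mult_mono) (auto simp: d_def)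
    also have "\<dots> = e / 2" using Suc.prems by (simp add: field_simps)
    finally show "d * (b - a) \<le> e / 2" .
  qed
  obtain p where p: "rat_poly p" "\<And>j x. j \<le> n \<Longrightarrow> x \<in> {a..b} \<Longrightarrow> \<bar>(deriv ^^ j) (\<lambda>x. poly p x - deriv u x) x\<bar> \<le> d"
    using Suc.IH[OF smooth_deriv[OF Suc.prems(1)] d(1) Suc.prems(3)] by blast
  define q where "q = poly_integral p"
  have q: "rat_poly q" "pderiv q = p"
    using p(1) by (simp_all add: q_def rat_poly_integral pderiv_poly_integral)
  obtain c where c: "c \<in> \<rat>" "\<bar>(u a - poly q a) - c\<bar> < e / 2"
    using rat_approx[of "e/2"] Suc.prems by auto
  let ?P = "[:c:] + q"
  let ?v = "\<lambda>x. poly ?P x - u x"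
  have sv: "smooth ?v" by (intro smooth_diff smooth_poly Suc.prems)
  have Dv: "(?v has_real_derivative poly p x - deriv u x) (at x)" for x
    using DERIV_diff[OF poly_DERIV[of ?P x] smooth_DERIV[OF Suc.prems(1), of x]] q(2) by (simp add: pderiv_add)
  then have dv: "deriv ?v = (\<lambda>x. poly p x - deriv u x)" by (auto intro: DERIV_imp_deriv)
  have "\<bar>(deriv ^^ j) ?v x\<bar> \<le> e" if j: "j \<le> Suc n" and x: "x \<in> {a..b}" for j x
  proof (cases j)
    case 0
    have "norm (?v x - ?v a) \<le> d * norm (x - a)"
    proof (rule field_differentiable_bound[of "{a..b}"])
      show "(?v has_real_derivative poly p z - deriv u z) (at z within {a..b})" for z
        using Dv by (rule has_field_derivative_at_within)
      show "norm (poly p z - deriv u z) \<le> d" if "z \<in> {a..b}" for z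
        using p(2)[of 0 z] that by simp
    qed (use x in auto)
    also have "d * norm (x - a) \<le> d * (b - a)"
      using x d(1) by (intro mult_left_mono) auto
    finally have "\<bar>?v x - ?v a\<bar> \<le> e / 2" using d(3) by simp
    moreover have "\<bar>?v a\<bar> < e / 2" using c(2) by (simp add: abs_if split: if_splits)
    ultimately have "\<bar>?v x\<bar> \<le> e" by linarith
    with 0 show ?thesis by simp
  next
    case (Suc i)
    then have "(deriv ^^ j) ?v x = (deriv ^^ i) (\<lambda>x. poly p x - deriv u x) x"
      by (simp only: funpow_Suc_right comp_apply dv)
    with p(2)[of i x] j x Suc d(2) show ?thesis by simp
  qed
  moreover have "rat_poly ?P" using q c by (auto simp: rat_poly_def coeff_pCons split: nat.splits)
  ultimately show ?case by blast
qed

section \<open>Termwise differentiation of series\<close>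

text \<open>The M-test makes each termwise differentiated series converge uniformly, so the family
  of their sums is closed under differentiation. The majorant may change with the order j; no bound
  uniform in j is asked for.\<close>

lemma smooth_suminf:
  fixes g :: "nat \<Rightarrow> real \<Rightarrow> real"
  assumes g: "\<And>k. smooth (g k)"
    and B: "\<And>j. summable (B j)" "\<And>j k x. \<bar>(deriv ^^ j) (g k) x\<bar> \<le> B j k"
  shows "smooth (\<lambda>x. \<Sum>k. g k x)"
    and "(deriv ^^ j) (\<lambda>x. \<Sum>k. g k x) x = (\<Sum>k. (deriv ^^ j) (g k) x)"
proof -
  let ?G = "\<lambda>j x. \<Sum>k. (deriv ^^ j) (g k) x"
  have D: "(?G j has_real_derivative ?G (Suc j) x) (at x)" for j x
  proof (rule has_field_derivative_series'(2)[where S = UNIV and ?x0.0 = 0])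
    show "uniformly_convergent_on UNIV (\<lambda>n x. \<Sum>i<n. (deriv ^^ Suc j) (g i) x)"
      by (rule Weierstrass_m_test'[where M = "B (Suc j)"]) (use B(1) B(2)[of "Suc j"] in auto)
    show "summable (\<lambda>n. (deriv ^^ j) (g n) 0)"
      by (rule summable_comparison_test'[OF B(1)[of j]]) (use B(2) in auto)
  qed (use smooth_funpow_DERIV[OF g] in auto)
  show "smooth (\<lambda>x. \<Sum>k. g k x)"
  proof (rule smoothI_class[where S = "range ?G"])
    show "(\<lambda>x. \<Sum>k. g k x) \<in> range ?G" by (auto intro: image_eqI[of _ _ 0])
    fix v assume "v \<in> range ?G"
    then obtain j where "v = ?G j" by blast
    then show "\<exists>v'\<in>range ?G. \<forall>x. (v has_real_derivative v' x) (at x)"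
      by (intro bexI[of _ "?G (Suc j)"]) (use D in simp, rule rangeI)
  qed
  have "(deriv ^^ j) (\<lambda>x. \<Sum>k. g k x) = ?G j"
  proof (induction j)
    case (Suc j)
    then show ?case using DERIV_imp_deriv[OF D[of j]] by auto
  qed simp
  then show "(deriv ^^ j) (\<lambda>x. \<Sum>k. g k x) x = ?G j x" by simp
qed

subsection \<open>Covering the Liouville and the algebraic numbers\<close>

lemma countable_algebraic_real: "countable {x :: real. Polynomial.algebraic x}"
proof -
  let ?I = "range (\<lambda>l :: int list. Poly (map real_of_int l)) - {0}"
  have "{x :: real. Polynomial.algebraic x} \<subseteq> (\<Union>p\<in>?I. {x. poly p x = 0})"
  proof
    fix x :: real assume "x \<in> {x. Polynomial.algebraic x}"
    then obtain p where p: "\<And>i. Polynomial.coeff p i \<in> \<int>" "p \<noteq> 0" "poly p x = 0"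
      by (auto simp: Polynomial.algebraic_def)
    have "\<forall>y\<in>set (coeffs p). \<exists>z. y = real_of_int z"
      using p(1) by (auto simp: coeffs_def elim: Ints_cases)
    then obtain l where "coeffs p = map real_of_int l" by (metis ex_map_conv)
    then have "p = Poly (map real_of_int l)" by (metis Poly_coeffs)
    with p show "x \<in> (\<Union>p\<in>?I. {x. poly p x = 0})" by blast
  qed
  moreover have "countable (\<Union>p\<in>?I. {x. poly p x = 0})"
    by (intro countable_UN countable_Diff countable_image) (auto intro: countable_finite poly_roots_finite)
  ultimately show ?thesis by (rule countable_subset)
qed

lemma countable_imp_negligible: "countable S \<Longrightarrow> negligible (S :: real set)"
  by (simp add: negligible_iff_null_sets null_sets_completionI countable_imp_null_set_lborel)

text \<open>A single large exponent N suffices. A Liouville number in [-M, M] lies within q^(-N) of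
  some p/q with q >= 2 and |p| <= (M + 1) q. For each q there are at most 3 (M + 1) q such
  intervals, and their total length over all q is small.\<close>

lemma negligible_Liouville_bounded: "negligible (Liouville_numbers \<inter> {-real M..real M})"
  unfolding negligible_outer
proof (intro allI impI)
  fix e :: real assume "e > 0"
  \<comment> \<open>The term q = 0 contributes \<open>inverse 0 = 0\<close>.\<close>
  define Z where "Z = (\<Sum>q. inverse (real q ^ 2))"
  have sZ: "summable (\<lambda>q. inverse (real q ^ 2))" by (rule inverse_power_summable) simp
  have Z0: "Z \<ge> 0" unfolding Z_def by (intro suminf_nonneg sZ) auto
  define C where "C = 6 * (real M + 1) * Z + 1"
  have "C > 0" using Z0 by (simp add: C_def add_nonneg_pos)
  obtain k where k: "(1/2) ^ k < e / C"
    using real_arch_pow_inv[of "e / C" "1/2"] \<open>e > 0\<close> \<open>C > 0\<close> by auto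
  \<comment> \<open>One power of q pays for the number of numerators, two make the sum over q
    converge, and the remaining k give the factor (1/2)^k because q >= 2.\<close>
  define N where "N = k + 3"
  let ?J = "\<lambda>q p. {real_of_int p / real q - 1 / real q ^ N <..< real_of_int p / real q + 1 / real q ^ N}"
  let ?P = "\<lambda>q. {- (int M + 1) * int q .. (int M + 1) * int q}"
  let ?A = "\<lambda>q. \<Union>p\<in>?P q. ?J q p"
  let ?T = "\<Union>q\<in>{2..}. ?A q"
  have mA: "?A q \<in> lmeasurable" for q by (intro fmeasurable.finite_UN) auto
  have bA: "measure lebesgue (?A q) \<le> 6 * (real M + 1) * (1/2)^k * inverse (real q ^ 2)" if "q \<ge> 2" for q
  proof -
    have "measure lebesgue (?A q) \<le> (\<Sum>p\<in>?P q. measure lebesgue (?J q p))"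
      by (intro measure_UNION_le) auto
    also have "\<dots> = real (card (?P q)) * (2 / real q ^ N)"
      by (simp add: measure_completion)
    also have "\<dots> \<le> (3 * (real M + 1) * real q) * (2 / real q ^ N)"
    proof (rule mult_right_mono)
      have "int (card (?P q)) = 2 * (int M + 1) * int q + 1" by (simp add: algebra_simps)
      also have "\<dots> \<le> 3 * (int M + 1) * int q"
      proof -
        have "1 * 1 \<le> (int M + 1) * int q" using that by (intro mult_mono) auto
        then show ?thesis by (simp add: algebra_simps)
      qed
      finally have "real_of_int (int (card (?P q))) \<le> real_of_int (3 * (int M + 1) * int q)"
        by (simp only: of_int_le_iff)
      then show "real (card (?P q)) \<le> 3 * (real M + 1) * real q"
        by (simp only: of_int_of_nat_eq of_int_mult of_int_add of_int_1 of_int_numeral)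
    qed simp
    also have "\<dots> = 6 * (real M + 1) * ((1 / real q) ^ k * inverse (real q ^ 2))"
      using that by (simp add: N_def power_add power2_eq_square power3_eq_cube field_simps)
    also have "\<dots> \<le> 6 * (real M + 1) * ((1/2) ^ k * inverse (real q ^ 2))"
      using that by (intro mult_left_mono mult_right_mono power_mono) (auto simp: field_simps)
    finally show ?thesis by (simp add: mult.assoc)
  qed
  have fin: "measure lebesgue (\<Union>q\<in>I. ?A q) \<le> 6 * (real M + 1) * (1/2)^k * Z"
    if "I \<subseteq> {2..}" "finite I" for I
  proof -
    have "measure lebesgue (\<Union>q\<in>I. ?A q) \<le> (\<Sum>q\<in>I. measure lebesgue (?A q))"
      using that mA by (intro measure_UNION_le) auto
    also have "\<dots> \<le> (\<Sum>q\<in>I. 6 * (real M + 1) * (1/2)^k * inverse (real q ^ 2))"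
      using that by (intro sum_mono bA) auto
    also have "\<dots> = 6 * (real M + 1) * (1/2)^k * (\<Sum>q\<in>I. inverse (real q ^ 2))"
      by (simp add: sum_distrib_left)
    also have "\<dots> \<le> 6 * (real M + 1) * (1/2)^k * Z"
      unfolding Z_def by (intro mult_left_mono sum_le_suminf sZ that) auto
    finally show ?thesis .
  qed
  have T: "?T \<in> lmeasurable" "measure lebesgue ?T \<le> 6 * (real M + 1) * (1/2)^k * Z"
    using fmeasurable_UN_bound[of "{2..}" ?A lebesgue "6 * (real M + 1) * (1/2)^k * Z"]
      measure_UN_bound[of "{2..}" ?A lebesgue "6 * (real M + 1) * (1/2)^k * Z"] mA fin by auto
  have "Liouville_numbers \<inter> {-real M..real M} \<subseteq> ?T"
  proof
    fix x assume "x \<in> Liouville_numbers \<inter> {-real M..real M}"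
    then have x: "x \<in> Liouville_numbers" "\<bar>x\<bar> \<le> real M" by auto
    have "N \<ge> 1" by (simp add: N_def)
    with x(1) obtain p q' where pq: "(q'::int) \<ge> 2" "\<bar>x - of_int p / of_int q'\<bar> < 1 / of_int q' ^ N"
      unfolding Liouville_numbers_def by blast
    define q where "q = nat q'"
    have q: "q \<ge> 2" "\<bar>x - of_int p / real q\<bar> < 1 / real q ^ N" using pq by (auto simp: q_def)
    have "1 / real q ^ N \<le> 1" using q by simp
    then have "\<bar>of_int p / real q\<bar> \<le> real M + 1" using q x by linarith
    then have "\<bar>of_int p\<bar> \<le> (real M + 1) * real q" using q by (simp add: abs_div field_simps)
    then have "real_of_int \<bar>p\<bar> \<le> real_of_int ((int M + 1) * int q)" by simp
    then have "\<bar>p\<bar> \<le> (int M + 1) * int q" by (simp only: of_int_le_iff)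
    then have "p \<in> ?P q" by (auto simp: abs_le_iff algebra_simps)
    moreover have "x \<in> ?J q p" using q(2) by (auto simp: abs_less_iff)
    ultimately show "x \<in> ?T" using q(1) by blast
  qed
  moreover have "measure lebesgue ?T < e"
  proof -
    have "6 * (real M + 1) * (1/2)^k * Z \<le> (1/2)^k * C" using Z0 by (simp add: C_def algebra_simps)
    also have "\<dots> < e" using k \<open>C > 0\<close> by (simp add: field_simps)
    finally show ?thesis using T(2) by linarith
  qed
  ultimately show "\<exists>T. Liouville_numbers \<inter> {-real M..real M} \<subseteq> T \<and> T \<in> lmeasurable \<and> measure lebesgue T < e"
    using T(1) by blast
qed

lemma negligible_Liouville: "negligible Liouville_numbers"
proof -
  have "Liouville_numbers = (\<Union>M. Liouville_numbers \<inter> {-real M..real M})"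
  proof (intro equalityI subsetI)
    fix x assume x: "x \<in> Liouville_numbers"
    obtain M where "\<bar>x\<bar> \<le> real M" using real_arch_simple by blast
    with x show "x \<in> (\<Union>M. Liouville_numbers \<inter> {-real M..real M})" by (intro UN_I[of M]) (auto simp: abs_le_iff)
  qed auto
  then show ?thesis using negligible_Liouville_bounded
    by (metis (no_types, lifting) negligible_Union_nat)
qed

section \<open>Perfect sets and their gaps\<close>

text \<open>Cantor-Bendixson: \<open>P\<close> consists of the condensation points of
  \<open>A\<close>, and only countably many points of \<open>A\<close> are lost.\<close>

lemma uncountable_closed_has_perfect_subset:
  fixes A :: "real set"
  assumes "closed A" "uncountable A"
  obtains P where "P \<subseteq> A" "closed P" "P \<noteq> {}" "\<And>x. x \<in> P \<Longrightarrow> x islimpt P"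
proof -
  define P where "P = {x. \<forall>u v. u < x \<and> x < v \<longrightarrow> uncountable (A \<inter> {u<..<v})}"
  have PA: "P \<subseteq> A"
  proof
    fix x assume x: "x \<in> P"
    have "\<exists>y\<in>A. dist y x < e" if "e > 0" for e
    proof -
      have "uncountable (A \<inter> {x - e<..<x + e})" using x that by (auto simp: P_def)
      then have "A \<inter> {x - e<..<x + e} \<noteq> {}" by auto
      then obtain y where "y \<in> A" "x - e < y" "y < x + e" by auto
      then show ?thesis by (intro bexI[of _ y]) (auto simp: dist_real_def abs_less_iff)
    qed
    then show "x \<in> A" using assms(1) by (metis closed_approachable)
  qed
  have AP: "countable (A - P)"
  proof -
    \<comment> \<open>Shrinking to rational endpoints leaves countably many intervals, each meeting
      \<open>A\<close> in a countable set.\<close>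
    have "A - P \<subseteq> (\<Union>(u,v)\<in>{(u,v). u \<in> \<rat> \<and> v \<in> \<rat> \<and> countable (A \<inter> {u<..<v})}. A \<inter> {u<..<v})"
    proof (rule subsetI)
      fix x assume x: "x \<in> A - P"
      then obtain u v where uv: "u < x" "x < v" "countable (A \<inter> {u<..<v})" by (auto simp: P_def)
      obtain u' v' where "u' \<in> \<rat>" "v' \<in> \<rat>" "u < u'" "u' < x" "x < v'" "v' < v"
        using Rats_dense_in_real uv by metis
      moreover have "countable (A \<inter> {u'<..<v'})"
        by (rule countable_subset[OF _ uv(3)]) (use calculation in auto)
      ultimately show "x \<in> (\<Union>(u,v)\<in>{(u,v). u \<in> \<rat> \<and> v \<in> \<rat> \<and> countable (A \<inter> {u<..<v})}. A \<inter> {u<..<v})"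
        using x by auto
    qed
    moreover have "countable {(u::real,v::real). u \<in> \<rat> \<and> v \<in> \<rat> \<and> countable (A \<inter> {u<..<v})}"
      by (rule countable_subset[of _ "\<rat> \<times> \<rat>"]) (auto intro: countable_rat)
    ultimately show ?thesis by (elim countable_subset) (auto intro!: countable_UN)
  qed
  have ne: "P \<noteq> {}" using AP assms(2) by auto
  have "open (- P)"
  proof (subst open_subopen, rule ballI)
    fix x assume "x \<in> - P"
    then obtain u v where uv: "u < x" "x < v" "countable (A \<inter> {u<..<v})" by (auto simp: P_def)
    have "{u<..<v} \<subseteq> - P" using uv(3) by (auto simp: P_def)
    with uv show "\<exists>T. open T \<and> x \<in> T \<and> T \<subseteq> - P" by (intro exI[of _ "{u<..<v}"]) auto
  qed
  then have cl: "closed P" by (simp add: closed_def)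
  have lim: "x islimpt P" if x: "x \<in> P" for x
  proof (rule ccontr)
    assume "\<not> x islimpt P"
    then obtain e where e: "e > 0" and no: "\<And>y. y \<in> P \<Longrightarrow> y \<noteq> x \<Longrightarrow> \<not> dist y x < e"
      unfolding islimpt_approachable by blast
    \<comment> \<open>Around an isolated point of \<open>P\<close> only that point and the countable
      remainder of \<open>A\<close> would be left, so it could not be a condensation point.\<close>
    have "A \<inter> {x - e<..<x + e} \<subseteq> (A - P) \<union> {x}"
      using no by (force simp: dist_real_def abs_less_iff)
    then have "countable (A \<inter> {x - e<..<x + e})"
      using AP by (meson countable_Un countable_finite countable_subset finite.intros)
    with x e show False by (auto simp: P_def)
  qed
  show ?thesis by (rule that[OF PA cl ne lim])
qed

text \<open>The gaps are the bounded components of the complement. Absence of isolated points keeps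
  their closures disjoint: a common endpoint would be isolated. Absence of rationals makes gaps
  occur arbitrarily close to \<open>lo\<close>, so there are infinitely many.\<close>

lemma perfect_set_gaps:
  fixes P :: "real set"
  assumes P: "compact P" "P \<noteq> {}" "\<And>x. x \<in> P \<Longrightarrow> x islimpt P" "P \<inter> \<rat> = {}"
  obtains a b :: "nat \<Rightarrow> real" and lo hi where "\<And>k. lo < a k" "\<And>k. a k < b k" "\<And>k. b k < hi"
    "\<And>j k. j \<noteq> k \<Longrightarrow> {a j..b j} \<inter> {a k..b k} = {}"
    "- P \<subseteq> {..<lo} \<union> {hi<..} \<union> (\<Union>k. {a k<..<b k})"
proof -
  have bdd: "bdd_above P" "bdd_below P" and cl: "closed P"
    using P(1) by (auto simp: compact_imp_bounded bounded_imp_bdd_above bounded_imp_bdd_below compact_imp_closed)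
  define lo where "lo = Inf P"
  define hi where "hi = Sup P"
  have lohi: "lo \<in> P" "hi \<in> P" "\<And>x. x \<in> P \<Longrightarrow> lo \<le> x \<and> x \<le> hi"
    using P(2) bdd cl by (auto simp: lo_def hi_def closed_contains_Inf closed_contains_Sup cInf_lower cSup_upper)
  define G where "G = {(a,b). a \<in> P \<and> b \<in> P \<and> a < b \<and> {a<..<b} \<inter> P = {}}"
  have GE: "a \<in> P" "b \<in> P" "a < b" "\<And>y. y \<in> P \<Longrightarrow> a < y \<Longrightarrow> y < b \<Longrightarrow> False" if "(a,b) \<in> G" for a b
    using that by (auto simp: G_def)
  \<comment> \<open>The radius is capped by b - a so that a point of \<open>P\<close> near a and to
    its right would fall into the gap; hence the point found lies to the left. The claim
    \<open>right\<close> is its mirror image.\<close>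
  have left: "\<exists>y\<in>P. a - e < y \<and> y < a" if "(a,b) \<in> G" "e > 0" for a b e
  proof -
    have "a islimpt P" "min e (b - a) > 0" using P(3) GE[OF that(1)] that(2) by auto
    then obtain y where "y \<in> P" "y \<noteq> a" "dist y a < min e (b - a)"
      unfolding islimpt_approachable by blast
    then show ?thesis using GE(4)[OF that(1), of y] by (intro bexI[of _ y]) (auto simp: dist_real_def abs_if split: if_splits)
  qed
  have right: "\<exists>y\<in>P. b < y \<and> y < b + e" if "(a,b) \<in> G" "e > 0" for a b e
  proof -
    have "b islimpt P" "min e (b - a) > 0" using P(3) GE[OF that(1)] that(2) by auto
    then obtain y where "y \<in> P" "y \<noteq> b" "dist y b < min e (b - a)"
      unfolding islimpt_approachable by blast
    then show ?thesis using GE(4)[OF that(1), of y] by (intro bexI[of _ y]) (auto simp: dist_real_def abs_if split: if_splits)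
  qed
  have gap: "\<exists>a b. (a,b) \<in> G \<and> a < x \<and> x < b" if x: "x \<notin> P" "lo < x" "x < hi" for x
  proof -
    \<comment> \<open>The gap around x is bounded by the nearest points of the closed set
      \<open>P\<close> on either side.\<close>
    let ?a = "Sup (P \<inter> {..x})" and ?b = "Inf (P \<inter> {x..})"
    have ne: "P \<inter> {..x} \<noteq> {}" "P \<inter> {x..} \<noteq> {}" using x lohi by force+
    have bd: "bdd_above (P \<inter> {..x})" "bdd_below (P \<inter> {x..})" by auto
    have a: "?a \<in> P \<inter> {..x}" using ne bd cl by (intro closed_contains_Sup) auto
    have b: "?b \<in> P \<inter> {x..}" using ne bd cl by (intro closed_contains_Inf) auto
    have ab: "?a < x" "x < ?b" using a b x(1) by (metis Int_iff atMost_iff atLeast_iff order_le_less)+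
    have "False" if "y \<in> P" "?a < y" "y < ?b" for y
    proof (cases "y \<le> x")
      case True
      with that have "y \<le> ?a" by (intro cSup_upper bd) auto
      with that show False by simp
    next
      case False
      with that have "?b \<le> y" by (intro cInf_lower bd) auto
      with that show False by simp
    qed
    then have "(?a, ?b) \<in> G" using a b ab by (auto simp: G_def)
    with ab show ?thesis by blast
  qed
  have lo_lt: "lo < a" "b < hi" if "(a,b) \<in> G" for a b
    using left[OF that, of 1] right[OF that, of 1] lohi(3) by force+
  have disj: "{a..b} \<inter> {c..d} = {}" if "(a,b) \<in> G" "(c,d) \<in> G" "a < c" for a b c d
  proof -
    have "b \<le> c" using GE[OF that(1)] GE[OF that(2)] that(3) by (meson not_le)
    moreover have "b \<noteq> c"
    proof
      assume "b = c"
      with left[OF that(2), of "b - a"] GE[OF that(1)] show False by auto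
    qed
    ultimately show ?thesis by auto
  qed
  have same: "b = d" if "(a,b) \<in> G" "(a,d) \<in> G" for a b d
    using GE[OF that(1)] GE[OF that(2)] by (meson linorder_neqE)
  have cG: "countable G"
  proof -
    \<comment> \<open>Any rational inside a gap determines both endpoints, so the gaps are an image
      of the rationals.\<close>
    have "G \<subseteq> (\<lambda>q. (Sup (P \<inter> {..q}), Inf (P \<inter> {q..}))) ` \<rat>"
    proof
      fix g assume g: "g \<in> G"
      obtain a b where gab: "g = (a,b)" by (cases g)
      note ab = GE[OF g[unfolded gab]]
      obtain q where q: "q \<in> \<rat>" "a < q" "q < b" using Rats_dense_in_real ab(3) by blast
      have "Sup (P \<inter> {..q}) = a"
        by (rule cSup_eq_maximum) (use ab(1) ab(4) q in \<open>auto simp: not_le[symmetric] intro: leI\<close>, meson ab(4) le_less_trans not_le)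
      moreover have "Inf (P \<inter> {q..}) = b"
        by (rule cInf_eq_minimum) (use ab(2) ab(4) q in \<open>auto simp: not_le[symmetric] intro: leI\<close>, meson ab(4) less_le_trans not_le)
      ultimately show "g \<in> (\<lambda>q. (Sup (P \<inter> {..q}), Inf (P \<inter> {q..}))) ` \<rat>" using gab q(1) by blast
    qed
    then show ?thesis using countable_rat by (meson countable_image countable_subset)
  qed
  \<comment> \<open>A rational between \<open>lo\<close> and v is not in \<open>P\<close>, so it
    lies in a gap, which starts to the left of v.\<close>
  have between: "\<exists>a b. (a,b) \<in> G \<and> a < v" if "lo < v" "v \<le> hi" for v
  proof -
    obtain q where q: "q \<in> \<rat>" "lo < q" "q < v" using Rats_dense_in_real \<open>lo < v\<close> by blast
    then have "q \<notin> P" using P(4) by blast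
    with gap[of q] q that show ?thesis by fastforce
  qed
  have "lo < hi"
  proof -
    obtain y where "y \<in> P" "y \<noteq> lo" using P(3)[OF lohi(1)] unfolding islimpt_approachable by (meson zero_less_one)
    then show ?thesis using lohi(3)[of y] by linarith
  qed
  \<comment> \<open>If there were finitely many gaps, one would have the least left endpoint a; but
    \<open>between\<close> finds a gap starting left of a.\<close>
  have iG: "infinite G"
  proof
    assume fin: "finite G"
    have ne: "G \<noteq> {}" using between[OF \<open>lo < hi\<close>] by auto
    then have "Min (fst ` G) \<in> fst ` G" using fin by (intro Min_in) auto
    then obtain a b where ab: "(a,b) \<in> G" "a = Min (fst ` G)" by auto
    then obtain c d where cd: "(c,d) \<in> G" "c < a"
      using between[of a] lo_lt[OF ab(1)] GE[OF ab(1)] lohi(3) by blast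
    then have "a \<le> c" unfolding ab(2) using fin by (intro Min_le) (auto intro!: image_eqI[of _ _ "(c,d)"])
    with cd show False by simp
  qed
  define g where "g = from_nat_into G"
  have bij: "bij_betw g UNIV G" unfolding g_def by (rule bij_betw_from_nat_into[OF cG iG])
  then have gG: "(fst (g k), snd (g k)) \<in> G" for k by (auto simp: bij_betw_def)
  show ?thesis
  proof
    show "lo < fst (g k)" "fst (g k) < snd (g k)" "snd (g k) < hi" for k
      using lo_lt[OF gG] GE(3)[OF gG] by auto
    show "{fst (g j)..snd (g j)} \<inter> {fst (g k)..snd (g k)} = {}" if "j \<noteq> k" for j k
    proof (cases "fst (g j)" "fst (g k)" rule: linorder_cases)
      case equal
      then have "g j = g k" using same[of "fst (g j)" "snd (g j)" "snd (g k)"] gG[of j] gG[of k]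
        by (simp add: prod_eq_iff)
      with that bij show ?thesis by (auto simp: bij_betw_def inj_on_def)
    next
      case less then show ?thesis using disj[OF gG gG] by blast
    next
      case greater then show ?thesis using disj[OF gG gG] by blast
    qed
    show "- P \<subseteq> {..<lo} \<union> {hi<..} \<union> (\<Union>k. {fst (g k)<..<snd (g k)})"
    proof
      fix x assume x: "x \<in> - P"
      show "x \<in> {..<lo} \<union> {hi<..} \<union> (\<Union>k. {fst (g k)<..<snd (g k)})"
      proof (cases "lo < x \<and> x < hi")
        case True
        then obtain a b where ab: "(a,b) \<in> G" "a < x" "x < b" using gap[of x] x by auto
        then obtain k where "g k = (a,b)" using bij by (metis bij_betw_def imageE)
        with ab show ?thesis by (intro UnI2 UN_I[of k]) auto
      next
        case False
        then show ?thesis using x lohi(1,2) by (metis ComplD Un_iff greaterThan_iff lessThan_iff linorder_neqE)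
      qed
    qed
  qed
qed

lemma Liouville_algebraic_cover:
  obtains a b :: "nat \<Rightarrow> real" and lo hi where "\<And>k. lo < a k" "\<And>k. a k < b k" "\<And>k. b k < hi"
    "\<And>j k. j \<noteq> k \<Longrightarrow> {a j..b j} \<inter> {a k..b k} = {}"
    "Liouville_numbers \<union> {x. Polynomial.algebraic x} \<subseteq> {..<lo} \<union> {hi<..} \<union> (\<Union>k. {a k<..<b k})"
proof -
  let ?N = "Liouville_numbers \<union> {x :: real. Polynomial.algebraic x}"
  have neg: "negligible ?N"
    by (intro negligible_Un negligible_Liouville countable_imp_negligible countable_algebraic_real)
  then have "?N \<in> sets lebesgue" by (simp add: negligible_iff_null_sets null_sets_def)
  \<comment> \<open>Outer regularity yields an open cover of measure below 1/2, less than the length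
    of [0, 1]; what is left of [0, 1] has positive measure and is therefore uncountable.\<close>
  then obtain V where V: "open V" "?N \<subseteq> V" "V - ?N \<in> lmeasurable" "emeasure lebesgue (V - ?N) < ennreal (1/2)"
    using sets_lebesgue_outer_open[of ?N "1/2"] by auto
  have mV: "V \<in> lmeasurable" "measure lebesgue V < 1/2"
  proof -
    have nn: "?N \<in> lmeasurable" "measure lebesgue ?N = 0"
      using neg negligible_imp_measurable negligible_imp_measure0 by blast+
    have eq: "V = (V - ?N) \<union> ?N" using V(2) by blast
    show "V \<in> lmeasurable" by (subst eq) (intro fmeasurable.Un V(3) nn)
    have "measure lebesgue V \<le> measure lebesgue (V - ?N) + measure lebesgue ?N"
      by (subst eq) (intro measure_Un_le fmeasurableD V(3) nn)
    moreover have "measure lebesgue (V - ?N) < 1/2"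
    proof -
      have "ennreal (measure lebesgue (V - ?N)) < ennreal (1/2)"
        using V(4) by (simp only: emeasure_eq_measure2[OF V(3)])
      then show ?thesis by (subst (asm) ennreal_less_iff) auto
    qed
    ultimately show "measure lebesgue V < 1/2" using nn by simp
  qed
  define A where "A = {0..1} - V"
  have "compact A" unfolding A_def by (intro compact_diff compact_Icc V)
  moreover have "uncountable A"
  proof
    assume "countable A"
    then have "A \<in> lmeasurable" "measure lebesgue A = 0"
      using countable_imp_negligible negligible_imp_measurable negligible_imp_measure0 by blast+
    then have "measure lebesgue (A \<union> V) \<le> 0 + measure lebesgue V"
      using measure_Un_le[of A lebesgue V] mV fmeasurableD by auto
    moreover have "measure lebesgue {0..1::real} \<le> measure lebesgue (A \<union> V)"
      using \<open>A \<in> lmeasurable\<close> mV by (intro measure_mono_fmeasurable) (auto simp: A_def)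
    ultimately show False using mV by (simp add: measure_completion)
  qed
  ultimately obtain P where P: "P \<subseteq> A" "closed P" "P \<noteq> {}" "\<And>x. x \<in> P \<Longrightarrow> x islimpt P"
    using uncountable_closed_has_perfect_subset[of A] compact_imp_closed by blast
  have "compact P" using P(1,2) \<open>compact A\<close> by (meson bounded_subset compact_eq_bounded_closed)
  have NP: "?N \<subseteq> - P" using P(1) V(2) by (auto simp: A_def)
  \<comment> \<open>Rationals are algebraic, hence covered by \<open>V\<close>.\<close>
  have PQ: "P \<inter> \<rat> = {}" using NP rat_imp_algebraic by blast
  show ?thesis
  proof (rule perfect_set_gaps[OF \<open>compact P\<close> P(3,4) PQ])
    fix a b :: "nat \<Rightarrow> real" and lo hi
    assume *: "\<And>k. lo < a k" "\<And>k. a k < b k" "\<And>k. b k < hi"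
      "\<And>j k. j \<noteq> k \<Longrightarrow> {a j..b j} \<inter> {a k..b k} = {}"
      "- P \<subseteq> {..<lo} \<union> {hi<..} \<union> (\<Union>k. {a k<..<b k})"
    show ?thesis by (rule that[OF *(1-4) order.trans[OF NP *(5)]])
  qed
qed

subsection \<open>Rational functions over the rationals\<close>

lemma rat_poly_const: "c \<in> \<rat> \<Longrightarrow> rat_poly [:c:]"
  by (simp add: rat_poly_def coeff_pCons split: nat.splits)

lemma rat_poly_add: "rat_poly p \<Longrightarrow> rat_poly q \<Longrightarrow> rat_poly (p + q)"
  by (simp add: rat_poly_def)

lemma rat_poly_diff: "rat_poly p \<Longrightarrow> rat_poly q \<Longrightarrow> rat_poly (p - q)"
  by (simp add: rat_poly_def)

lemma rat_poly_mult: "rat_poly p \<Longrightarrow> rat_poly q \<Longrightarrow> rat_poly (p * q)"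
  by (auto simp: rat_poly_def coeff_mult intro!: Rats_sum Rats_mult)

lemma rat_poly_power: "rat_poly p \<Longrightarrow> rat_poly (p ^ n)"
  by (induction n) (use rat_poly_const[of 1] in \<open>auto simp: one_pCons intro!: rat_poly_mult\<close>)

lemma rat_poly_pderiv: "rat_poly p \<Longrightarrow> rat_poly (pderiv p)"
  by (auto simp: rat_poly_def coeff_pderiv intro!: Rats_mult)

lemma rat_poly_pCons_iff: "rat_poly (pCons a p) \<longleftrightarrow> a \<in> \<rat> \<and> rat_poly p"
proof
  assume *: "rat_poly (pCons a p)"
  then have "Polynomial.coeff (pCons a p) 0 \<in> \<rat>" "\<And>i. Polynomial.coeff (pCons a p) (Suc i) \<in> \<rat>"
    unfolding rat_poly_def by blast+
  then show "a \<in> \<rat> \<and> rat_poly p" by (simp add: rat_poly_def)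
qed (auto simp: rat_poly_def coeff_pCons split: nat.splits)

text \<open>The denominator has no real zero, so these functions are smooth on the whole line and no
  value rests on division by zero.\<close>

definition rat_fun :: "(real \<Rightarrow> real) \<Rightarrow> bool" where
  "rat_fun F \<longleftrightarrow> (\<exists>P Q. rat_poly P \<and> rat_poly Q \<and> (\<forall>x. poly Q x \<noteq> 0 \<and> F x = poly P x / poly Q x))"

lemma rat_fun_smooth: "rat_fun F \<Longrightarrow> smooth F"
proof -
  assume "rat_fun F"
  then obtain P Q where F: "\<And>x. poly Q x \<noteq> 0" "\<And>x. F x = poly P x / poly Q x"
    unfolding rat_fun_def by blast
  have "F = (\<lambda>x. poly P x / poly Q x)" using F by auto
  moreover have "smooth (\<lambda>x. poly P x / poly Q x)" by (intro smooth_divide smooth_poly F)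
  ultimately show ?thesis by simp
qed

lemma rat_fun_deriv: assumes "rat_fun F" shows "rat_fun (deriv F)"
proof -
  obtain P Q where PQ: "rat_poly P" "rat_poly Q" and F: "\<And>x. poly Q x \<noteq> 0" "\<And>x. F x = poly P x / poly Q x"
    using assms unfolding rat_fun_def by blast
  have "deriv F x = poly (pderiv P * Q - P * pderiv Q) x / poly (Q * Q) x" for x
  proof -
    have "F = (\<lambda>x. poly P x / poly Q x)" using F by auto
    moreover have "((\<lambda>x. poly P x / poly Q x) has_real_derivative
        (poly (pderiv P) x * poly Q x - poly P x * poly (pderiv Q) x) / (poly Q x * poly Q x)) (at x)"
      by (intro DERIV_divide poly_DERIV F)
    ultimately show ?thesis by (auto intro: DERIV_imp_deriv)
  qed
  then show ?thesis unfolding rat_fun_def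
    using F(1) by (intro exI[of _ "pderiv P * Q - P * pderiv Q"] exI[of _ "Q * Q"] conjI
        rat_poly_mult rat_poly_diff rat_poly_pderiv PQ allI) (simp only: poly_mult mult_eq_0_iff, simp)
qed

lemma rat_fun_funpow_deriv: "rat_fun F \<Longrightarrow> rat_fun ((deriv ^^ m) F)"
  by (induction m) (auto intro: rat_fun_deriv)

section \<open>Poles at plus and minus i, and nonconstant derivatives\<close>

lemma funpow_deriv_const_imp_poly:
  assumes "smooth F" "(deriv ^^ m) F = (\<lambda>x. c)" shows "\<exists>S. F = poly S"
  using assms
proof (induction m arbitrary: F)
  case 0 then show ?case by (intro exI[of _ "[:c:]"]) auto
next
  case (Suc m)
  have "(deriv ^^ m) (deriv F) = (\<lambda>x. c)" using Suc.prems(2) by (simp only: funpow_Suc_right comp_apply)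
  from Suc.IH[OF smooth_deriv[OF Suc.prems(1)] this] obtain S where S: "deriv F = poly S" by blast
  let ?R = "poly_integral S"
  have R: "pderiv ?R = S" by (rule pderiv_poly_integral)
  have "((\<lambda>x. F x - poly ?R x) has_real_derivative 0) (at x)" for x
    using DERIV_diff[OF smooth_DERIV[OF Suc.prems(1), of x] poly_DERIV[of ?R x]] S R by simp
  then have "F x - poly ?R x = F 0 - poly ?R 0" for x by (rule DERIV_isconst_all[rule_format]) 
  then have "F x = poly (?R + [:F 0 - poly ?R 0:]) x" for x by (simp add: algebra_simps)
  then show ?case by blast
qed

text \<open>Coprimality of the numerator with \<open>1 + x\<^sup>2\<close> forces genuine poles at \<open>\<plusminus>\<i>\<close>. This property survives
  composition with \<open>T(x) + c / (1 + x\<^sup>2)\<close>, since \<open>T\<close> fixes infinity and the second summand vanishes there.\<close>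

definition polar :: "(real \<Rightarrow> real) \<Rightarrow> bool" where
  "polar F \<longleftrightarrow> (\<exists>P W. rat_poly P \<and> rat_poly W \<and> coprime P [:1, 0, 1:] \<and>
     (\<forall>x. poly W x \<noteq> 0 \<and> F x = poly P x / ((1 + x\<^sup>2) * poly W x)))"

lemma one_plus_square: "1 + (x::real)\<^sup>2 > 0" "1 + (x::real)\<^sup>2 \<noteq> 0"
  by (auto simp: add_pos_nonneg) (smt (verit) zero_le_power2)

lemma poly_one_plus_square: "poly [:1, 0, 1:] (x::real) = 1 + x\<^sup>2" by (simp add: power2_eq_square)

lemma rat_poly_one_plus_square: "rat_poly [:1, 0, 1:]"
  by (auto simp: rat_poly_def coeff_pCons split: nat.splits)

lemma polar_rat_fun: "polar F \<Longrightarrow> rat_fun F"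
  unfolding polar_def rat_fun_def
proof (elim exE conjE)
  fix P W assume "rat_poly P" "rat_poly W" and F: "\<forall>x. poly W x \<noteq> 0 \<and> F x = poly P x / ((1 + x\<^sup>2) * poly W x)"
  then show "\<exists>P Q. rat_poly P \<and> rat_poly Q \<and> (\<forall>x. poly Q x \<noteq> 0 \<and> F x = poly P x / poly Q x)"
    by (intro exI[of _ P] exI[of _ "[:1,0,1:] * W"] conjI rat_poly_mult rat_poly_one_plus_square allI)
      (simp_all only: poly_mult poly_one_plus_square mult_eq_0_iff one_plus_square(2) simp_thms)
qed

text \<open>If F were a polynomial S, then P = (1 + x^2) W S, so the nonunit 1 + x^2 would divide P,
  against coprimality.\<close>

lemma polar_not_poly: "polar F \<Longrightarrow> F \<noteq> poly S"
proof
  assume "polar F" "F = poly S"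
  then obtain P W where cop: "coprime P [:1, 0, 1:]"
    and F: "\<And>x. poly W x \<noteq> 0" "\<And>x. poly S x = poly P x / ((1 + x\<^sup>2) * poly W x)"
    unfolding polar_def by blast
  have "poly P = poly ([:1, 0, 1:] * (W * S))"
  proof
    fix x
    have "poly P x = (1 + x\<^sup>2) * poly W x * poly S x" using F one_plus_square(2)[of x] by simp
    then show "poly P x = poly ([:1, 0, 1:] * (W * S)) x" by (simp only: poly_mult poly_one_plus_square mult.assoc)
  qed
  then have "P = [:1, 0, 1:] * (W * S)" by (simp only: poly_eq_poly_eq_iff)
  then have "[:1, 0, 1:] dvd P" by (rule dvdI)
  with cop have "is_unit [:1, 0, 1 :: real:]" by (meson coprime_common_divisor dvd_refl)
  then show False by (simp add: is_unit_iff_degree)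
qed

lemma polar_funpow_deriv_nonconst: "polar F \<Longrightarrow> (deriv ^^ m) F \<noteq> (\<lambda>x. c)"
  using funpow_deriv_const_imp_poly polar_not_poly polar_rat_fun rat_fun_smooth by metis

text \<open>Modulo \<open>D\<close> the polynomial \<open>N\<close> is a nonzero multiple of
  \<open>R\<close>, and common divisors with \<open>D\<close> depend only on this residue.\<close>

lemma coprimeI_mod:
  fixes N R D :: "real poly"
  assumes "N = Polynomial.smult c R + D * S" "c \<noteq> 0" "coprime R D" shows "coprime N D"
proof (rule coprimeI)
  fix d assume d: "d dvd N" "d dvd D"
  then have "d dvd N - D * S" by (intro dvd_diff) auto
  then have "d dvd R" using assms by (simp add: dvd_smult_cancel)
  with d(2) assms(3) show "is_unit d" by (meson coprime_common_divisor)
qed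

lemma polar_piece:
  assumes "rat_poly T" "c \<in> \<rat>" "c \<noteq> 0"
  shows "polar (\<lambda>x. poly T x + c / (1 + x\<^sup>2))"
  unfolding polar_def
proof (intro exI conjI allI)
  show "coprime ([:1,0,1:] * T + [:c:]) [:1, 0, 1:]"
    by (rule coprimeI_mod[of _ c 1 _ T]) (simp add: one_pCons, use assms in simp_all)
  show "rat_poly ([:1,0,1:] * T + [:c:])"
    by (intro rat_poly_add rat_poly_mult rat_poly_one_plus_square rat_poly_const assms)
  show "rat_poly 1" using rat_poly_power[OF assms(1), of 0] by simp
  show "poly 1 x \<noteq> 0" for x :: real by simp
  show "poly T x + c / (1 + x\<^sup>2) = poly ([:1,0,1:] * T + [:c:]) x / ((1 + x\<^sup>2) * poly 1 x)" for x
    using one_plus_square(2)[of x] by (simp only: poly_add poly_mult poly_one_plus_square) (simp add: field_simps)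
qed

text \<open>Clearing denominators turns T(P/Q) into a sum of multiples of P^i Q^(t - i) with t the
  degree of T; every term except the leading one is divisible by Q. The rest is collected in
  \<open>S\<close>, so that reduction modulo a divisor of Q keeps only the leading term. The
  induction follows Horner's scheme.\<close>

lemma homogenize:
  assumes "rat_poly T" "rat_poly P" "rat_poly Q"
  shows "\<exists>S. rat_poly S \<and> (\<forall>x. poly Q x \<noteq> 0 \<longrightarrow>
    poly Q x ^ Polynomial.degree T * poly T (poly P x / poly Q x) =
    Polynomial.lead_coeff T * poly P x ^ Polynomial.degree T + poly Q x * poly S x)"
  using assms(1)
proof (induction T)
  case 0 then show ?case by (intro exI[of _ 0]) (simp add: rat_poly_def)
next
  case (pCons a T)
  show ?case
  \<comment> \<open>The degree of \<open>pCons a T\<close> is one more than that of \<open>T\<close>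
    only for nonzero \<open>T\<close>; a constant is its own leading term and takes S = 0.\<close>
  proof (cases "T = 0")
    case True then show ?thesis by (intro exI[of _ 0]) (simp add: rat_poly_def)
  next
    case False
    let ?t = "Polynomial.degree T"
    have "rat_poly T" using pCons(3) by (simp add: rat_poly_pCons_iff)
    from pCons(2)[OF this] obtain S where S: "rat_poly S" "\<And>x. poly Q x \<noteq> 0 \<Longrightarrow>
      poly Q x ^ ?t * poly T (poly P x / poly Q x) = Polynomial.lead_coeff T * poly P x ^ ?t + poly Q x * poly S x"
      by blast
    have "rat_poly ([:a:] * Q ^ ?t + P * S)"
      using pCons(3) by (intro rat_poly_add rat_poly_mult rat_poly_power rat_poly_const assms S(1)) (simp add: rat_poly_pCons_iff)
    moreover have "poly Q x ^ Suc ?t * poly (pCons a T) (poly P x / poly Q x) =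
        Polynomial.lead_coeff T * poly P x ^ Suc ?t + poly Q x * poly ([:a:] * Q ^ ?t + P * S) x"
      if "poly Q x \<noteq> 0" for x
    proof -
      have aux: "q ^ Suc t * (a + p / q * v) = q * (a * q ^ t) + p * (q ^ t * v)" if "q \<noteq> 0" for q p v :: real and t
      proof -
        have "q ^ Suc t * (a + p / q * v) = q * (a * q ^ t) + q * (p / q) * (q ^ t * v)"
          by (simp only: power_Suc distrib_left mult_ac)
        also have "q * (p / q) = p" using that by simp
        finally show ?thesis .
      qed
      have "poly Q x ^ Suc ?t * poly (pCons a T) (poly P x / poly Q x) =
        poly Q x * (a * poly Q x ^ ?t) + poly P x * (poly Q x ^ ?t * poly T (poly P x / poly Q x))"
        by (simp only: poly_pCons aux[OF that])
      also have "\<dots> = Polynomial.lead_coeff T * poly P x ^ Suc ?t + poly Q x * poly ([:a:] * Q ^ ?t + P * S) x"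
      proof -
        have "poly ([:a:] * Q ^ ?t + P * S) x = a * poly Q x ^ ?t + poly P x * poly S x" by simp
        then show ?thesis by (simp only: S(2)[OF that]) (simp add: algebra_simps)
      qed
      finally show ?thesis .
    qed
    moreover have "Polynomial.degree (pCons a T) = Suc ?t"
      "Polynomial.lead_coeff (pCons a T) = Polynomial.lead_coeff T" using False by simp_all
    ultimately show ?thesis by (intro exI[of _ "[:a:] * Q ^ ?t + P * S"] conjI allI impI)
        (simp_all only:)
  qed
qed

text \<open>Write F = P/Q with Q = (1 + x^2) W. Over the denominator Q^t (Q^2 + P^2), which has no
  real zero, the numerator is congruent to tau P^(t + 2) modulo 1 + x^2, with tau the leading
  coefficient of T. It is therefore again coprime to 1 + x^2. Since t >= 1, one factor 1 + x^2 of
  Q^t can be split off to leave \<open>W'\<close>.\<close>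

lemma polar_compose:
  assumes "polar F" "rat_poly T" "Polynomial.degree T \<ge> 1" "c \<in> \<rat>"
  shows "polar (\<lambda>x. poly T (F x) + c / (1 + (F x)\<^sup>2))"
proof -
  let ?D = "[:1, 0, 1:] :: real poly"
  obtain P W where PW: "rat_poly P" "rat_poly W" "coprime P ?D"
    and F: "\<And>x. poly W x \<noteq> 0" "\<And>x. F x = poly P x / ((1 + x\<^sup>2) * poly W x)"
    using assms(1) unfolding polar_def by blast
  define Q where "Q = ?D * W"
  have Qx: "poly Q x = (1 + x\<^sup>2) * poly W x" for x by (simp only: Q_def poly_mult poly_one_plus_square)
  have Q: "rat_poly Q" "\<And>x. poly Q x \<noteq> 0" "\<And>x. F x = poly P x / poly Q x"
    using F one_plus_square(2) rat_poly_mult[OF rat_poly_one_plus_square PW(2)] by (simp_all only: Qx mult_eq_0_iff simp_thms Q_def[symmetric])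
  define t where "t = Polynomial.degree T"
  define \<tau> where "\<tau> = Polynomial.lead_coeff T"
  have \<tau>: "\<tau> \<noteq> 0" "\<tau> \<in> \<rat>" and t: "t \<ge> 1" using assms by (auto simp: \<tau>_def t_def rat_poly_def)
  obtain S where S: "rat_poly S" "\<And>x. poly Q x ^ t * poly T (poly P x / poly Q x) = \<tau> * poly P x ^ t + poly Q x * poly S x"
    using homogenize[OF assms(2) PW(1) Q(1)] Q(2) unfolding t_def \<tau>_def by blast
  define N where "N = ([:\<tau>:] * P ^ t + Q * S) * (Q ^ 2 + P ^ 2) + [:c:] * Q ^ (t + 2)"
  define W' where "W' = W * Q ^ (t - 1) * (Q ^ 2 + P ^ 2)"
  have "coprime (P ^ (t + 2)) ?D" using PW(3) by (simp add: coprime_power_left_iff)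
  moreover have "N = Polynomial.smult \<tau> (P ^ (t + 2)) + ?D * (W * ([:\<tau>:] * P ^ t * Q + S * (Q ^ 2 + P ^ 2) + [:c:] * Q ^ (t + 1)))"
  proof -
    have "N = [:\<tau>:] * P ^ (t + 2) + Q * ([:\<tau>:] * P ^ t * Q + S * (Q ^ 2 + P ^ 2) + [:c:] * Q ^ (t + 1))"
      unfolding N_def by (simp only: power_add power_one_right power2_eq_square ring_distribs mult_ac add_ac)
    then show ?thesis unfolding Q_def by (simp only: mult.assoc) simp
  qed
  ultimately have cop: "coprime N ?D" using coprimeI_mod[OF _ \<tau>(1)] by blast
  have rN: "rat_poly N" unfolding N_def
    by (intro rat_poly_add rat_poly_mult rat_poly_power rat_poly_const \<tau> assms PW Q S)
  have rW: "rat_poly W'" unfolding W'_def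
    by (intro rat_poly_add rat_poly_mult rat_poly_power PW Q)
  have val: "poly W' x \<noteq> 0 \<and> poly T (F x) + c / (1 + (F x)\<^sup>2) = poly N x / ((1 + x\<^sup>2) * poly W' x)" for x
  proof -
    define p q where "p = poly P x" and "q = poly Q x"
    have q: "q \<noteq> 0" using Q by (simp add: q_def)
    have pq: "q\<^sup>2 + p\<^sup>2 > 0" using q by (simp add: add_pos_nonneg)
    have W': "poly W' x = poly W x * q ^ (t - 1) * (q\<^sup>2 + p\<^sup>2)" by (simp add: W'_def p_def q_def)
    have "(1 + x\<^sup>2) * poly W' x = q * q ^ (t - 1) * (q\<^sup>2 + p\<^sup>2)"
      unfolding W' q_def Qx by (simp only: mult.assoc)
    also have "q * q ^ (t - 1) = q ^ t" using t by (metis power_Suc Suc_diff_1 less_le_trans zero_less_one)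
    finally have den: "(1 + x\<^sup>2) * poly W' x = q ^ t * (q\<^sup>2 + p\<^sup>2)" .
    have "q ^ t * poly T (F x) = \<tau> * p ^ t + q * poly S x"
      using S(2)[of x] Q(3)[of x] by (simp add: p_def q_def)
    then have "poly T (F x) = (\<tau> * p ^ t + q * poly S x) / q ^ t" using q by (simp add: field_simps)
    moreover have "c / (1 + (F x)\<^sup>2) = (c * q\<^sup>2) / (q\<^sup>2 + p\<^sup>2)"
    proof -
      have "1 + (F x)\<^sup>2 = (q\<^sup>2 + p\<^sup>2) / q\<^sup>2" using q by (simp add: Q(3) p_def q_def field_simps)
      then show ?thesis by simp
    qed
    ultimately have "poly T (F x) + c / (1 + (F x)\<^sup>2) =
      ((\<tau> * p ^ t + q * poly S x) * (q\<^sup>2 + p\<^sup>2) + (c * q\<^sup>2) * q ^ t) / (q ^ t * (q\<^sup>2 + p\<^sup>2))"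
      using q pq by (simp add: add_frac_eq)
    also have "(\<tau> * p ^ t + q * poly S x) * (q\<^sup>2 + p\<^sup>2) + (c * q\<^sup>2) * q ^ t = poly N x"
      by (simp add: N_def p_def q_def power_add power2_eq_square)
    finally show ?thesis using den F q pq W' by simp
  qed
  show ?thesis unfolding polar_def using cop rN rW val by blast
qed

section \<open>Maillet's theorem on Liouville numbers\<close>

text \<open>The point is uniformity: \<open>c\<close> and \<open>d\<close> depend on P alone, so
  denominators of values at p/q grow at most like a fixed power of q. In Horner form each
  coefficient contributes one factor q and its own denominator.\<close>

lemma rat_poly_common_denominator:
  assumes "rat_poly P"
  shows "\<exists>c d. c > (0::int) \<and> (\<forall>p q :: int. q \<noteq> 0 \<longrightarrow> (\<exists>A :: int.
    of_int c * of_int q ^ d * poly P (of_int p / of_int q) = of_int A))"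
  using assms
proof (induction P)
  case 0 show ?case by (rule exI[of _ 1], rule exI[of _ 0]) (auto intro: exI[of _ 0])
next
  case (pCons a P)
  have "rat_poly P" "a \<in> \<rat>" using pCons(3) by (simp_all add: rat_poly_pCons_iff)
  from pCons(2)[OF this(1)] obtain c d where cd: "c > 0" "\<And>p q :: int. q \<noteq> 0 \<Longrightarrow> \<exists>A :: int.
    of_int c * of_int q ^ d * poly P (of_int p / of_int q) = of_int A" by blast
  obtain m n :: int where mn: "n > 0" "a = of_int m / of_int n" using \<open>a \<in> \<rat>\<close> using Rats_cases' by metis
  show ?case
  proof (rule exI[of _ "n * c"], rule exI[of _ "Suc d"], intro conjI allI impI)
    show "n * c > 0" using mn cd by simp
    fix p q :: int assume q: "q \<noteq> 0"
    obtain A where A: "of_int c * of_int q ^ d * poly P (of_int p / of_int q) = of_int A" using cd(2)[OF q] by blast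
    have aux: "n * c * (q * r) * (m / n + p / q * v) = c * (q * r) * m + n * p * (c * r * v)"
      if "q \<noteq> 0" "n \<noteq> 0" for n c q r m p v :: real
    proof -
      have "n * c * (q * r) * (m / n + p / q * v) = c * (q * r) * (n * (m / n)) + n * (q * (p / q)) * (c * r * v)"
        by (simp only: distrib_left mult_ac)
      with that show ?thesis by simp
    qed
    have "of_int (n * c) * of_int q ^ Suc d * poly (pCons a P) (of_int p / of_int q) =
      of_int c * (of_int q * of_int q ^ d) * of_int m + of_int n * of_int p * (of_int c * of_int q ^ d * poly P (of_int p / of_int q))"
      unfolding poly_pCons mn(2) of_int_mult power_Suc by (rule aux) (use q mn in auto)
    also have "\<dots> = of_int (c * (q * q ^ d) * m + n * p * A)"
      unfolding A by simp
    finally show "\<exists>A. of_int (n * c) * of_int q ^ Suc d * poly (pCons a P) (of_int p / of_int q) = real_of_int A" by blast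
  qed
qed

text \<open>A fraction p/q close to xi has an image a/b with b <= C q^d, and F is Lipschitz near xi.
  Approximating xi to an exponent exceeding d N therefore approximates F(xi) to exponent N. The
  distance is nonzero because F takes the value F(xi) at finitely many points only.\<close>

lemma rat_fun_Liouville:
  assumes F: "rat_fun F" and nc: "\<And>c. F \<noteq> (\<lambda>x. c)" and \<xi>: "\<xi> \<in> Liouville_numbers"
  shows "F \<xi> \<in> Liouville_numbers"
proof -
  obtain P Q where PQ: "rat_poly P" "rat_poly Q" and FPQ: "\<And>x. poly Q x \<noteq> 0" "\<And>x. F x = poly P x / poly Q x"
    using F unfolding rat_fun_def by blast
  define R where "R = P - Polynomial.smult (F \<xi>) Q"
  have R: "F x = F \<xi> \<longleftrightarrow> poly R x = 0" for x
    using FPQ(1)[of x] unfolding FPQ(2)[of x] R_def by (simp add: field_simps)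
  have "R \<noteq> 0"
  proof
    assume "R = 0" then have "F = (\<lambda>x. F \<xi>)" using R by auto
    with nc show False by blast
  qed
  then have "finite {x. poly R x = 0}" by (rule poly_roots_finite)
  \<comment> \<open>Within distance \<open>\<delta>\<close> no other point has the value F(xi), so
    the image of a nearby fraction differs from F(xi).\<close>
  from finite_set_avoid[OF this, of \<xi>] obtain \<delta> where
    \<delta>: "\<delta> > 0" "\<And>x. F x = F \<xi> \<Longrightarrow> x \<noteq> \<xi> \<Longrightarrow> \<delta> \<le> dist \<xi> x" using R by auto
  let ?I = "{\<xi> - 1..\<xi> + 1}"
  have bd: "\<exists>M\<ge>1. \<forall>x\<in>?I. \<bar>g x\<bar> \<le> M" if "smooth g" for g
  proof -
    have "bounded (g ` ?I)" by (intro compact_imp_bounded compact_continuous_image smooth_continuous_on that compact_Icc)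
    then obtain B where "\<forall>x\<in>?I. \<bar>g x\<bar> \<le> B" unfolding bounded_pos by auto
    then show ?thesis by (intro exI[of _ "max 1 B"]) (auto simp: le_max_iff_disj)
  qed
  obtain L where L: "L \<ge> 1" "\<And>x. x \<in> ?I \<Longrightarrow> \<bar>deriv F x\<bar> \<le> L"
    using bd[OF smooth_deriv[OF rat_fun_smooth[OF F]]] by blast
  obtain M where M: "M \<ge> 1" "\<And>x. x \<in> ?I \<Longrightarrow> \<bar>poly Q x\<bar> \<le> M" using bd[OF smooth_poly] by blast
  have Lip: "\<bar>F x - F \<xi>\<bar> \<le> L * \<bar>x - \<xi>\<bar>" if "x \<in> ?I" for x
  proof -
    have "norm (F x - F \<xi>) \<le> L * norm (x - \<xi>)"
    proof (rule field_differentiable_bound[of ?I])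
      show "(F has_real_derivative deriv F z) (at z within ?I)" for z
        using smooth_DERIV[OF rat_fun_smooth[OF F]] by (rule has_field_derivative_at_within)
    qed (use that L in auto)
    then show ?thesis by simp
  qed
  obtain c1 d1 where c1: "c1 > (0::int)" "\<And>p q :: int. q \<noteq> 0 \<Longrightarrow> \<exists>A :: int.
    of_int c1 * of_int q ^ d1 * poly P (of_int p / of_int q) = of_int A"
    using rat_poly_common_denominator[OF PQ(1)] by blast
  obtain c2 d2 where c2: "c2 > (0::int)" "\<And>p q :: int. q \<noteq> 0 \<Longrightarrow> \<exists>A :: int.
    of_int c2 * of_int q ^ d2 * poly Q (of_int p / of_int q) = of_int A"
    using rat_poly_common_denominator[OF PQ(2)] by blast
  define C where "C = 2 * of_int c1 * of_int c2 * M"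
  define d where "d = d1 + d2"
  have "C > 0" using c1 c2 M by (simp add: C_def)
  have main: "\<exists>p q::int. q \<ge> 2 \<and> 0 < \<bar>F \<xi> - of_int p / of_int q\<bar> \<and> \<bar>F \<xi> - of_int p / of_int q\<bar> < 1 / of_int q ^ N"
    if "N \<ge> 1" for N
  proof -
    \<comment> \<open>Since q >= 2, the factor q^(-K) is at most (1/2)^K; it absorbs the Lipschitz
      constant and C^N and keeps p/q within both \<open>\<delta>\<close> and the unit interval
      around xi.\<close>
    obtain K where K: "(1/2) ^ K < min (min \<delta> 1) (1 / (L * C ^ N))"
      using real_arch_pow_inv[of "min (min \<delta> 1) (1 / (L * C ^ N))" "1/2"] \<delta> L \<open>C > 0\<close> by auto
    \<comment> \<open>The added 1 makes the exponent admissible in the definition of Liouville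
      numbers even when K = d = 0.\<close>
    have "K + d * N + 1 \<ge> 1" by simp
    with \<xi> obtain p q :: int where pq: "q \<ge> 2" "0 < \<bar>\<xi> - of_int p / of_int q\<bar>"
      "\<bar>\<xi> - of_int p / of_int q\<bar> < 1 / of_int q ^ (K + d * N + 1)"
      unfolding Liouville_numbers_def by blast
    define x where "x = real_of_int p / of_int q"
    have q2: "real_of_int q \<ge> 2" using pq(1) by linarith
    have qK: "1 / real_of_int q ^ K \<le> (1/2) ^ K"
      using q2 by (simp add: power_one_over frac_le power_mono)
    have near: "\<bar>\<xi> - x\<bar> < 1 / of_int q ^ K * (1 / of_int q ^ (d * N))"
    proof -
      have "1 / real_of_int q ^ (K + d * N + 1) \<le> 1 / real_of_int q ^ (K + d * N)"
        using q2 by (intro divide_left_mono power_increasing) auto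
      then show ?thesis using pq(3) by (simp add: x_def power_add)
    qed
    also have "\<dots> \<le> 1 / of_int q ^ K * 1"
      using q2 by (intro mult_left_mono) auto
    finally have near2: "\<bar>\<xi> - x\<bar> < \<delta>" "\<bar>\<xi> - x\<bar> < 1" using qK K by auto
    have xI: "x \<in> ?I" using near2 by auto
    have ne: "F x \<noteq> F \<xi>" using \<delta>(2)[of x] near2 pq(2) by (auto simp: dist_real_def x_def)
    obtain A where A: "of_int c1 * of_int q ^ d1 * poly P x = of_int A" using c1(2)[of q p] q2 by (auto simp: x_def)
    obtain B where B: "of_int c2 * of_int q ^ d2 * poly Q x = of_int B" using c2(2)[of q p] q2 by (auto simp: x_def)
    have "real_of_int B \<noteq> 0" unfolding B[symmetric] using FPQ c2 q2 by simp
    then have B0: "B \<noteq> 0" by simp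
    \<comment> \<open>The sign of B is moved to the numerator to make b positive, and the factor 2
      secures b >= 2.\<close>
    define a b where "a = 2 * A * c2 * q ^ d2 * sgn B" and "b = 2 * \<bar>B\<bar> * c1 * q ^ d1"
    have b2: "b \<ge> 2"
    proof -
      have "1 \<le> \<bar>B\<bar> * c1 * q ^ d1" using B0 c1 q2 by (simp add: int_one_le_iff_zero_less)
      then show ?thesis by (simp add: b_def)
    qed
    have ab: "F x = of_int a / of_int b"
    proof -
      have a': "2 * sgn B * (A * c2 * q ^ d2) = a" by (simp add: a_def mult_ac)
      have "2 * sgn B * (B * c1 * q ^ d1) = 2 * (B * sgn B) * c1 * q ^ d1" by (simp only: mult_ac)
      then have b': "2 * sgn B * (B * c1 * q ^ d1) = b" by (simp only: b_def abs_sgn)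
      have "F x = (of_int c1 * of_int q ^ d1 * poly P x * (of_int c2 * of_int q ^ d2)) /
          (of_int c2 * of_int q ^ d2 * poly Q x * (of_int c1 * of_int q ^ d1))"
        using FPQ c1 c2 q2 by (simp add: field_simps)
      also have "\<dots> = of_int (A * c2 * q ^ d2) / of_int (B * c1 * q ^ d1)" unfolding A B by simp
      also have "\<dots> = of_int (2 * sgn B) * of_int (A * c2 * q ^ d2) / (of_int (2 * sgn B) * of_int (B * c1 * q ^ d1))"
        using B0 by (subst mult_divide_mult_cancel_left) (auto simp: sgn_if)
      also have "\<dots> = of_int a / of_int b" by (simp only: of_int_mult[symmetric] a' b')
      finally show ?thesis .
    qed
    have bC: "real_of_int b \<le> C * of_int q ^ d"
    proof -
      have "real_of_int \<bar>B\<bar> = of_int c2 * of_int q ^ d2 * \<bar>poly Q x\<bar>"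
        using c2 q2 by (simp add: B[symmetric] abs_mult)
      also have "\<dots> \<le> of_int c2 * of_int q ^ d2 * M"
        using c2 q2 M(2)[OF xI] by (intro mult_left_mono) auto
      finally have "real_of_int b \<le> 2 * (of_int c2 * of_int q ^ d2 * M) * of_int c1 * of_int q ^ d1"
        unfolding b_def of_int_mult of_int_power using c1 q2 by (intro mult_right_mono) auto
      also have "\<dots> = C * of_int q ^ d" by (simp add: C_def d_def power_add)
      finally show ?thesis .
    qed
    have "\<bar>F \<xi> - F x\<bar> \<le> L * \<bar>\<xi> - x\<bar>" using Lip[OF xI] by (simp add: abs_minus_commute)
    also have "\<dots> < L * (1 / of_int q ^ K * (1 / of_int q ^ (d * N)))"
      using near L by (intro mult_strict_left_mono) auto
    also have "\<dots> \<le> L * (1 / (L * C ^ N) * (1 / of_int q ^ (d * N)))"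
      using qK K L q2 by (intro mult_left_mono mult_right_mono) auto
    also have "\<dots> = 1 / (C * of_int q ^ d) ^ N"
      using L by (simp add: power_mult_distrib power_mult)
    also have "\<dots> \<le> 1 / of_int b ^ N"
      using bC b2 \<open>C > 0\<close> q2 by (intro divide_left_mono power_mono mult_pos_pos zero_less_power) auto
    finally have "\<bar>F \<xi> - of_int a / of_int b\<bar> < 1 / of_int b ^ N" by (simp add: ab)
    moreover have "0 < \<bar>F \<xi> - of_int a / of_int b\<bar>" using ne ab by simp
    ultimately show ?thesis using b2 by blast
  qed
  then show ?thesis unfolding Liouville_numbers_def by blast
qed

subsection \<open>Number fields\<close>

lemma type_algebra_nat_pow: "x [^]\<^bsub>(ring_of_type_algebra :: real ring)\<^esub> (n::nat) = x ^ n"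
proof -
  interpret R: Ring.field "ring_of_type_algebra :: real ring" by (rule field_from_type_algebra)
  show ?thesis
  proof (induction n)
    case 0 then show ?case by (simp add: ring_of_type_algebra_def)
  next
    case (Suc n)
    have "x [^]\<^bsub>(ring_of_type_algebra :: real ring)\<^esub> Suc n =
      x [^]\<^bsub>(ring_of_type_algebra :: real ring)\<^esub> n * x"
      by (simp add: ring_of_type_algebra_def)
    with Suc show ?case by simp
  qed
qed

text \<open>The algebraic library lists coefficients from the leading one down, whereas
  \<open>Poly\<close> starts with the constant term; hence \<open>rev\<close>.\<close>

lemma type_algebra_eval:
  "ring.eval (ring_of_type_algebra :: real ring) p x = poly (Poly (rev p)) x"
proof -
  interpret R: Ring.field "ring_of_type_algebra :: real ring" by (rule field_from_type_algebra)
  show ?thesis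
  proof (induction p)
    case Nil
    have "R.eval [] x = 0" by (simp only: R.eval.simps) (simp add: ring_of_type_algebra_def)
    then show ?case by simp
  next
    case (Cons a p)
    have "R.eval (a # p) x = a * (x [^]\<^bsub>(ring_of_type_algebra :: real ring)\<^esub> length p) + R.eval p x"
      by (simp only: R.eval.simps) (simp add: ring_of_type_algebra_def)
    with Cons show ?case by (simp add: type_algebra_nat_pow Poly_append poly_monom)
  qed
qed

lemma type_algebra_inv:
  assumes "x \<noteq> (0::real)" shows "inv\<^bsub>(ring_of_type_algebra :: real ring)\<^esub> x = inverse x"
proof -
  interpret R: Ring.field "ring_of_type_algebra :: real ring" by (rule field_from_type_algebra)
  have "x \<in> Units (ring_of_type_algebra :: real ring)"
    using assms by (simp add: R.field_Units) (simp add: ring_of_type_algebra_def)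
  from R.Units_r_inv[OF this] have "x * inv\<^bsub>(ring_of_type_algebra :: real ring)\<^esub> x = 1"
    by (simp add: ring_of_type_algebra_def)
  then show ?thesis by (metis inverse_unique)
qed

lemma subfield_Rats: "subfield \<rat> (ring_of_type_algebra :: real ring)"
proof -
  interpret R: Ring.field "ring_of_type_algebra :: real ring" by (rule field_from_type_algebra)
  have neg: "\<ominus>\<^bsub>(ring_of_type_algebra :: real ring)\<^esub> x = - x" for x
  proof -
    have "x + \<ominus>\<^bsub>(ring_of_type_algebra :: real ring)\<^esub> x = 0"
      using R.r_neg[of x] by (simp add: ring_of_type_algebra_def)
    then show ?thesis by simp
  qed
  show ?thesis
  proof (rule R.subfieldI')
    show "subring \<rat> (ring_of_type_algebra :: real ring)"
      by (rule R.subringI) (auto simp: neg, auto simp: ring_of_type_algebra_def)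
    show "inv\<^bsub>(ring_of_type_algebra :: real ring)\<^esub> k \<in> \<rat>"
      if "k \<in> \<rat> - {\<zero>\<^bsub>(ring_of_type_algebra :: real ring)\<^esub>}" for k
    proof -
      have "k \<noteq> 0" "k \<in> \<rat>" using that by (auto simp: ring_of_type_algebra_def)
      then show ?thesis by (simp add: type_algebra_inv)
    qed
  qed
qed

lemma real_number_field_algebraic:
  assumes K: "real_number_field K" and x: "x \<in> K" shows "Polynomial.algebraic x"
proof -
  interpret R: Ring.field "ring_of_type_algebra :: real ring" by (rule field_from_type_algebra)
  have sK: "subfield K (ring_of_type_algebra :: real ring)"
    and fd: "ring.finite_dimension (ring_of_type_algebra :: real ring) \<rat> K"
    using K by (auto simp: real_number_field_def)
  have "(R.algebraic over \<rat>) x"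
    by (rule R.finite_dimension_imp_algebraic[OF subfield_Rats subfieldE(1)[OF sK] fd x])
  then obtain p where p: "p \<in> carrier (univ_poly (ring_of_type_algebra :: real ring) \<rat>)" "p \<noteq> []"
    "R.eval p x = \<zero>\<^bsub>(ring_of_type_algebra :: real ring)\<^esub>"
    using R.algebraicE[OF subfieldE(1)[OF subfield_Rats], of x] by (auto simp: ring_of_type_algebra_def)
  then have "polynomial\<^bsub>(ring_of_type_algebra :: real ring)\<^esub> \<rat> p"
    using univ_poly_carrier by blast
  then have pr: "set p \<subseteq> \<rat>" and hd: "hd p \<noteq> 0"
    using p(2) by (auto simp: polynomial_def ring_of_type_algebra_def)
  let ?q = "Poly (rev p)"
  \<comment> \<open>After reversal the head of the list is the top coefficient; it is nonzero for a
    normalized polynomial, so \<open>?q\<close> is not the zero polynomial.\<close>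
  have "Polynomial.coeff ?q (length p - 1) = hd p"
    using p(2) by (simp add: coeff_Poly_eq nth_default_def rev_nth hd_conv_nth)
  with hd have "?q \<noteq> 0" by (metis Polynomial.coeff_0)
  moreover have "poly ?q x = 0"
    using p(3) by (simp add: type_algebra_eval) (simp add: ring_of_type_algebra_def)
  moreover have "Polynomial.coeff ?q i \<in> \<rat>" for i
    using pr by (auto simp: coeff_Poly_eq nth_default_def rev_nth)
  ultimately show ?thesis by (metis algebraicI')
qed

lemma real_number_field_closed:
  assumes K: "real_number_field K"
  shows "\<And>x y. x \<in> K \<Longrightarrow> y \<in> K \<Longrightarrow> x + y \<in> K" "\<And>x y. x \<in> K \<Longrightarrow> y \<in> K \<Longrightarrow> x * y \<in> K"
    "\<And>x. x \<in> K \<Longrightarrow> inverse x \<in> K" "\<rat> \<subseteq> K"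
proof -
  interpret R: Ring.field "ring_of_type_algebra :: real ring" by (rule field_from_type_algebra)
  have sK: "subfield K (ring_of_type_algebra :: real ring)"
    and fd: "ring.finite_dimension (ring_of_type_algebra :: real ring) \<rat> K"
    using K by (auto simp: real_number_field_def)
  note sr = subringE[OF subfieldE(1)[OF sK]]
  show add: "x + y \<in> K" if "x \<in> K" "y \<in> K" for x y
    using sr(7)[OF that] by (simp add: ring_of_type_algebra_def)
  show mult: "x * y \<in> K" if "x \<in> K" "y \<in> K" for x y
    using sr(6)[OF that] by (simp add: ring_of_type_algebra_def)
  have zero: "0 \<in> K" and one: "1 \<in> K" using sr(2,3) by (simp_all add: ring_of_type_algebra_def)
  show inv: "inverse x \<in> K" if "x \<in> K" for x
  \<comment> \<open>For x = 0 the convention \<open>inverse 0 = 0\<close> keeps the value in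
    K.\<close>
  proof (cases "x = 0")
    case False
    with that have "x \<in> K - {\<zero>\<^bsub>(ring_of_type_algebra :: real ring)\<^esub>}" by (simp add: ring_of_type_algebra_def)
    from R.subfield_m_inv(1)[OF sK this] False show ?thesis by (simp add: type_algebra_inv)
  qed (use zero in simp)
  have neg: "- x \<in> K" if "x \<in> K" for x
  proof -
    have "x + \<ominus>\<^bsub>(ring_of_type_algebra :: real ring)\<^esub> x = 0"
      using R.r_neg[of x] by (simp add: ring_of_type_algebra_def)
    then have "\<ominus>\<^bsub>(ring_of_type_algebra :: real ring)\<^esub> x = - x" by simp
    with sr(5)[OF that] show ?thesis by simp
  qed
  have nat: "real n \<in> K" for n by (induction n) (use zero one add in \<open>auto simp: add.commute\<close>)
  have int: "real_of_int i \<in> K" for i using nat neg by (cases i rule: int_cases2) auto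
  show "\<rat> \<subseteq> K"
  proof
    fix x :: real assume "x \<in> \<rat>"
    then obtain a b :: int where "x = of_int a / of_int b" using Rats_cases' by metis
    then have "x = of_int a * inverse (of_int b)" by (simp add: divide_inverse)
    with mult[OF int inv[OF int]] show "x \<in> K" by simp
  qed
qed

lemma rat_fun_number_field:
  assumes K: "real_number_field K" and F: "rat_fun F" and x: "x \<in> K"
  shows "F x \<in> K"
proof -
  note K' = real_number_field_closed[OF K]
  have p: "poly P x \<in> K" if "rat_poly P" for P
    using that
  proof (induction P)
    case 0 then show ?case using K'(4) by auto
  next
    case (pCons a P)
    then have "a \<in> K" "poly P x \<in> K" using K'(4) by (auto simp: rat_poly_pCons_iff)
    with K'(1,2) x show ?case by simp
  qed
  obtain P Q where "rat_poly P" "rat_poly Q" "\<And>x. F x = poly P x / poly Q x"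
    using F unfolding rat_fun_def by blast
  then show ?thesis using p K'(2,3) by (simp add: divide_inverse)
qed

subsection \<open>Iterates and transcendence\<close>

text \<open>Equality on a neighbourhood makes all derivatives at x agree as well. The condition c
  \<noteq> 0 starts the induction over iterates through \<open>polar_piece\<close>, and a
  nonconstant T carries it on through \<open>polar_compose\<close>.\<close>

definition locally_polar :: "(real \<Rightarrow> real) \<Rightarrow> real \<Rightarrow> bool" where
  "locally_polar f x \<longleftrightarrow> (\<exists>T c. rat_poly T \<and> Polynomial.degree T \<ge> 1 \<and> c \<in> \<rat> \<and> c \<noteq> 0 \<and>
     eventually (\<lambda>y. f y = poly T y + c / (1 + y\<^sup>2)) (nhds x))"

lemma isCont_funpow: "(\<And>x. isCont f x) \<Longrightarrow> isCont (f ^^ n) x" for f :: "real \<Rightarrow> real"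
proof (induction n)
  case (Suc n)
  then show ?case using isCont_o2[of x "f ^^ n" f] by simp
qed (simp add: id_def)

lemma funpow_mem: "f ` E \<subseteq> E \<Longrightarrow> x \<in> E \<Longrightarrow> (f ^^ n) x \<in> E"
  by (induction n) auto

text \<open>Invariance of \<open>E\<close> keeps the orbit at points where f is locally a piece.
  Continuity of the iterate pulls the neighbourhood of the image point back to one of x, where the
  piece is composed with the polar function found so far.\<close>

lemma locally_polar_funpow:
  assumes f: "\<And>x. isCont f x" and E: "\<And>x. x \<in> E \<Longrightarrow> locally_polar f x" "f ` E \<subseteq> E" and x: "x \<in> E"
  shows "\<exists>F. polar F \<and> eventually (\<lambda>y. (f ^^ Suc n) y = F y) (nhds x)"
proof (induction n)
  case 0
  from E(1)[OF x] obtain T c where "rat_poly T" "c \<in> \<rat>" "c \<noteq> 0"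
    "eventually (\<lambda>y. f y = poly T y + c / (1 + y\<^sup>2)) (nhds x)" unfolding locally_polar_def by blast
  with polar_piece[of T c] show ?case by auto
next
  case (Suc n)
  let ?g = "f ^^ Suc n"
  from Suc obtain F where F: "polar F" "eventually (\<lambda>y. ?g y = F y) (nhds x)" by blast
  have "?g x \<in> E" by (rule funpow_mem[OF E(2) x])
  from E(1)[OF this] obtain T c where T: "rat_poly T" "Polynomial.degree T \<ge> 1" "c \<in> \<rat>"
    "eventually (\<lambda>y. f y = poly T y + c / (1 + y\<^sup>2)) (nhds (?g x))" unfolding locally_polar_def by blast
  have "filterlim ?g (nhds (?g x)) (nhds x)"
    using isCont_funpow[where f = f and n = "Suc n" and x = x, OF f] by (simp only: isCont_def tendsto_at_iff_tendsto_nhds)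
  with T(4) have "eventually (\<lambda>y. f (?g y) = poly T (?g y) + c / (1 + (?g y)\<^sup>2)) (nhds x)"
    by (rule eventually_compose_filterlim)
  with F(2) have "eventually (\<lambda>y. (f ^^ Suc (Suc n)) y = poly T (F y) + c / (1 + (F y)\<^sup>2)) (nhds x)"
    by eventually_elim simp
  with polar_compose[OF F(1) T(1-3)] show ?case by blast
qed

lemma locally_polar_value:
  assumes "locally_polar f x" obtains F where "polar F" "f x = F x"
proof -
  from assms obtain T c where "rat_poly T" "c \<in> \<rat>" "c \<noteq> 0"
    "eventually (\<lambda>y. f y = poly T y + c / (1 + y\<^sup>2)) (nhds x)" unfolding locally_polar_def by blast
  then show ?thesis
    using that[of "\<lambda>y. poly T y + c / (1 + y\<^sup>2)"] polar_piece[of T c] eventually_nhds_x_imp_x by blast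
qed

lemma polar_Liouville: "polar F \<Longrightarrow> \<xi> \<in> Liouville_numbers \<Longrightarrow> (deriv ^^ m) F \<xi> \<in> Liouville_numbers"
  by (rule rat_fun_Liouville)
    (auto intro: rat_fun_funpow_deriv polar_rat_fun dest: polar_funpow_deriv_nonconst)

lemma polar_number_field:
  "real_number_field K \<Longrightarrow> polar F \<Longrightarrow> x \<in> K \<Longrightarrow> (deriv ^^ m) F x \<in> K"
  by (rule rat_fun_number_field) (auto intro: rat_fun_funpow_deriv polar_rat_fun)

text \<open>Here \<open>E\<close> stands for a number field or for the set of Liouville numbers. The
  case m = 0 of \<open>cl\<close> first gives invariance under f; then all derivatives of the
  iterate at x can be read off from the polar function with the same germ.\<close>

lemma funpow_deriv_image_subset:
  assumes f: "\<And>x. isCont f x" and E: "\<And>x. x \<in> E \<Longrightarrow> locally_polar f x"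
    and cl: "\<And>F m x. polar F \<Longrightarrow> x \<in> E \<Longrightarrow> (deriv ^^ m) F x \<in> E" and n: "n \<ge> 1"
  shows "(deriv ^^ m) (f ^^ n) ` E \<subseteq> E"
proof
  have fE: "f ` E \<subseteq> E"
  proof
    fix y assume "y \<in> f ` E"
    then obtain x where x: "x \<in> E" "y = f x" by auto
    from locally_polar_value[OF E[OF x(1)]] obtain F where "polar F" "f x = F x" .
    with cl[of F x 0] x show "y \<in> E" by simp
  qed
  fix y assume "y \<in> (deriv ^^ m) (f ^^ n) ` E"
  then obtain x where x: "x \<in> E" "y = (deriv ^^ m) (f ^^ n) x" by auto
  obtain k where k: "n = Suc k" using n by (cases n) auto
  obtain F where F: "polar F" "eventually (\<lambda>y. (f ^^ n) y = F y) (nhds x)"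
    using locally_polar_funpow[OF f E fE x(1)] k by blast
  have "y = (deriv ^^ m) F x" unfolding x(2) by (rule higher_deriv_cong_ev[OF F(2) refl])
  with cl[OF F(1) x(1)] show "y \<in> E" by simp
qed

lemma locally_polar_imp_invariant:
  assumes "smooth f" and lp: "\<And>x. x \<in> Liouville_numbers \<union> {x. Polynomial.algebraic x} \<Longrightarrow> locally_polar f x"
  shows "\<forall>K. real_number_field K \<longrightarrow> (\<forall>n::nat\<ge>1. \<forall>m::nat. (deriv ^^ m) (f ^^ n) ` K \<subseteq> K)"
    and "\<forall>n::nat\<ge>1. \<forall>m::nat. (deriv ^^ m) (f ^^ n) ` Liouville_numbers \<subseteq> Liouville_numbers"
proof -
  have f: "isCont f x" for x using smooth_DERIV[OF assms(1)] by (rule DERIV_isCont)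
  show "\<forall>K. real_number_field K \<longrightarrow> (\<forall>n::nat\<ge>1. \<forall>m::nat. (deriv ^^ m) (f ^^ n) ` K \<subseteq> K)"
    by (intro allI impI funpow_deriv_image_subset f)
      (use lp real_number_field_algebraic polar_number_field in blast)+
  show "\<forall>n::nat\<ge>1. \<forall>m::nat. (deriv ^^ m) (f ^^ n) ` Liouville_numbers \<subseteq> Liouville_numbers"
    by (intro allI impI funpow_deriv_image_subset f) (use lp polar_Liouville in blast)+
qed

section \<open>Transcendence over the rational functions\<close>

text \<open>Substituting a rational function for Y yields a polynomial up to powers of 1 + x^2, so
  that vanishing on an interval spreads to the whole line.\<close>

lemma eval_rational_numerator:
  fixes P :: "real poly poly" and A :: "real poly"
  shows "\<exists>N n. \<forall>x. poly (poly P [:poly A x / (1 + x\<^sup>2):]) x * (1 + x\<^sup>2) ^ n = poly N x"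
proof (induction P)
  case 0 show ?case by (intro exI[of _ 0]) auto
next
  case (pCons p P)
  then obtain N n where N: "\<And>x. poly (poly P [:poly A x / (1 + x\<^sup>2):]) x * (1 + x\<^sup>2) ^ n = poly N x" by blast
  have "poly (poly (pCons p P) [:poly A x / (1 + x\<^sup>2):]) x * (1 + x\<^sup>2) ^ Suc n = poly (p * [:1, 0, 1:] ^ Suc n + A * N) x" for x
  proof -
    let ?D = "1 + x\<^sup>2" and ?v = "poly (poly P [:poly A x / (1 + x\<^sup>2):]) x"
    have "poly (poly (pCons p P) [:poly A x / ?D:]) x * ?D ^ Suc n = (poly p x + poly A x / ?D * ?v) * (?D * ?D ^ n)"
      by simp
    also have "\<dots> = poly p x * (?D * ?D ^ n) + (?D * (poly A x / ?D)) * (?v * ?D ^ n)"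
    proof -
      have "(p + r * v) * (d * e) = p * (d * e) + (d * r) * (v * e)" for p r v d e :: real
        by (simp add: algebra_simps)
      then show ?thesis .
    qed
    also have "?D * (poly A x / ?D) = poly A x" using one_plus_square(2)[of x] by simp
    finally show ?thesis unfolding N by (simp only: poly_add poly_mult poly_power poly_one_plus_square power_Suc)
  qed
  then show ?case by blast
qed

text \<open>A polynomial of degree \<open>d\<close> over \<open>\<real>(x)\<close> would vanish at \<open>d + 1\<close> pieces, which take distinct values at
  all but finitely many points.\<close>

lemma infinitely_many_pieces_imp_transcendental:
  fixes f :: "real \<Rightarrow> real"
  assumes ab: "\<And>k::nat. a k < b k"
    and f: "\<And>k x. a k < x \<Longrightarrow> x < b k \<Longrightarrow> f x = poly (T k) x + c k / (1 + x\<^sup>2)"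
    and c: "inj c"
  shows "transcendental_over_Rx UNIV f"
  unfolding transcendental_over_Rx_def algebraic_over_Rx_def
proof
  assume "\<exists>P :: real poly poly. P \<noteq> 0 \<and> (\<forall>x\<in>UNIV. poly (poly P [:f x:]) x = 0)"
  then obtain P :: "real poly poly" where P: "P \<noteq> 0" "\<And>x. poly (poly P [:f x:]) x = 0" by blast
  let ?D = "[:1, 0, 1:] :: real poly"
  define A where "A k = ?D * T k + [:c k:]" for k
  define R where "R k x = poly (A k) x / (1 + x\<^sup>2)" for k x
  have R: "R k x = poly (T k) x + c k / (1 + x\<^sup>2)" for k x
    using one_plus_square(2)[of x] unfolding R_def A_def poly_add poly_mult poly_one_plus_square by (simp add: field_simps)
  have zero: "poly (poly P [:R k x:]) x = 0" for k x
  proof -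
    obtain N n where N: "\<And>x. poly (poly P [:R k x:]) x * (1 + x\<^sup>2) ^ n = poly N x"
      unfolding R_def using eval_rational_numerator by blast
    \<comment> \<open>On the k-th interval the piece coincides with f, so \<open>N\<close> has
      infinitely many zeros and must vanish.\<close>
    have "{a k<..<b k} \<subseteq> {x. poly N x = 0}"
    proof
      fix x assume "x \<in> {a k<..<b k}"
      then have "R k x = f x" using f[of k x] R by simp
      with P(2)[of x] N[of x] show "x \<in> {x. poly N x = 0}" by simp
    qed
    then have "N = 0" using infinite_Ioo[OF ab[of k]] poly_roots_finite finite_subset by blast
    with N[of x] one_plus_square(2)[of x] show ?thesis by simp
  qed
  \<comment> \<open>Modulo 1 + x^2 the difference is the nonzero constant c_i - c_j, so it is
    coprime to 1 + x^2 and cannot be 0.\<close>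
  have ne: "A i - A j \<noteq> 0" if "i \<noteq> j" for i j
  proof
    assume "A i - A j = 0"
    moreover have "coprime (A i - A j) ?D"
      by (rule coprimeI_mod[of _ "c i - c j" 1 _ "T i - T j"])
        (simp add: A_def one_pCons algebra_simps, use that c in \<open>auto dest: injD\<close>)
    ultimately have "is_unit ?D" by simp
    then show False by (simp add: is_unit_iff_degree)
  qed
  let ?d = "Polynomial.degree P"
  \<comment> \<open>Excluded are the points where the leading coefficient in Y vanishes and those
    where two of the first d + 1 pieces meet. Elsewhere the specialised polynomial \<open>q\<close>
    is nonzero with d + 1 distinct roots.\<close>
  let ?bad = "{x. poly (Polynomial.lead_coeff P) x = 0} \<union> (\<Union>i\<le>?d. \<Union>j\<in>{..?d} - {i}. {x. poly (A i - A j) x = 0})"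
  have "finite ?bad" using P(1) ne by (intro finite_UnI finite_UN_I poly_roots_finite) auto
  then obtain x where x: "x \<notin> ?bad" using ex_new_if_finite[OF infinite_UNIV_char_0] by blast
  define q where "q = map_poly (\<lambda>p. poly p x) P"
  have q_eval: "poly (map_poly (\<lambda>p. poly p x) P') y = poly (poly P' [:y:]) x" for P' y
    by (induction P') (auto simp: map_poly_pCons)
  have "Polynomial.coeff q ?d \<noteq> 0" using x by (simp add: q_def coeff_map_poly)
  then have q0: "q \<noteq> 0" by auto
  have "Polynomial.degree q \<le> ?d" unfolding q_def by (rule map_poly_degree_leq)
  have "inj_on (\<lambda>i. R i x) {..?d}"
  proof (rule inj_onI, rule ccontr)
    fix i j assume ij: "i \<in> {..?d}" "j \<in> {..?d}" "R i x = R j x" "i \<noteq> j"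
    then have "poly (A i - A j) x = 0" using one_plus_square(2)[of x] by (simp add: R_def)
    with ij x show False by auto
  qed
  then have "?d + 1 = card ((\<lambda>i. R i x) ` {..?d})" by (simp add: card_image)
  also have "\<dots> \<le> card {y. poly q y = 0}"
    using zero by (intro card_mono poly_roots_finite q0) (auto simp: q_def q_eval)
  also have "\<dots> \<le> Polynomial.degree q" by (rule card_poly_roots_bound[OF q0])
  finally show False using \<open>Polynomial.degree q \<le> ?d\<close> by simp
qed

subsection \<open>Construction of the diffeomorphism\<close>

lemma smooth_one_plus_square: "smooth (\<lambda>x. 1 / (1 + x\<^sup>2))"
proof -
  have "smooth (\<lambda>x. 1 / poly [:1, 0, 1:] x)"
    by (intro smooth_divide smooth_const smooth_poly) (simp only: poly_one_plus_square one_plus_square(2) not_False_eq_True)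
  then show ?thesis by (simp only: poly_one_plus_square)
qed

lemma funpow_deriv_const_le: "\<bar>(deriv ^^ j) (\<lambda>x. t) x\<bar> \<le> \<bar>t :: real\<bar>"
proof (cases j)
  case (Suc i)
  have "(deriv ^^ Suc i) (\<lambda>x. t) = (deriv ^^ i) (\<lambda>x. 0 :: real)"
    unfolding funpow_Suc_right comp_apply by simp
  with Suc show ?thesis by (simp only: funpow_deriv_const0 abs_zero abs_ge_zero)
qed simp

lemma smooth_cmult_small:
  fixes a b e :: real
  assumes "smooth h" "e > 0"
  shows "\<exists>s>0. \<forall>t. \<bar>t\<bar> \<le> s \<longrightarrow> (\<forall>j\<le>n. \<forall>x\<in>{a..b}. \<bar>(deriv ^^ j) (\<lambda>x. h x * t) x\<bar> \<le> e)"
proof -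
  obtain s where s: "s > 0" "\<And>u. smooth u \<Longrightarrow> (\<forall>j\<le>n. \<forall>x\<in>{a..b}. \<bar>(deriv ^^ j) u x\<bar> \<le> s) \<Longrightarrow>
    (\<forall>j\<le>n. \<forall>x\<in>{a..b}. \<bar>(deriv ^^ j) (\<lambda>x. h x * u x) x\<bar> \<le> e)"
    using smooth_mult_small[OF assms, of n a b] by blast
  have "\<forall>j\<le>n. \<forall>x\<in>{a..b}. \<bar>(deriv ^^ j) (\<lambda>x. h x * t) x\<bar> \<le> e" if "\<bar>t\<bar> \<le> s" for t
    by (rule s(2)[OF smooth_const]) (use that funpow_deriv_const_le order_trans in blast)
  with s(1) show ?thesis by blast
qed

lemma rat_between_0: assumes "(s::real) > 0" obtains q where "q \<in> \<rat>" "0 < q" "q < s"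
  using Rats_dense_in_real[OF assms] by blast

section \<open>Corrections on the gaps\<close>

text \<open>A rational Weierstrass polynomial is perturbed by a small linear term, to make it
  nonconstant, and by a small multiple of 1 / (1 + x^2), to create the pole; each costs e/3.\<close>

lemma polar_approximation:
  fixes a b e C :: real
  assumes u: "smooth u" and "a \<le> b" "e > 0" "C > 0"
  shows "\<exists>T c. rat_poly T \<and> Polynomial.degree T \<ge> 1 \<and> c \<in> \<rat> \<and> 0 < c \<and> c < C \<and>
    (\<forall>j\<le>n. \<forall>x\<in>{a..b}. \<bar>(deriv ^^ j) (\<lambda>x. poly T x + c / (1 + x\<^sup>2) - u x) x\<bar> \<le> e)"
proof -
  have e3: "e / 3 > 0" using assms by simp
  obtain p where p: "rat_poly p" "\<And>j x. j \<le> n \<Longrightarrow> x \<in> {a..b} \<Longrightarrow> \<bar>(deriv ^^ j) (\<lambda>x. poly p x - u x) x\<bar> \<le> e / 3"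
    using Weierstrass_smooth_rat[OF u e3 assms(2), of n] by blast
  obtain s1 where s1: "s1 > 0" "\<And>t j x. \<bar>t\<bar> \<le> s1 \<Longrightarrow> j \<le> n \<Longrightarrow> x \<in> {a..b} \<Longrightarrow> \<bar>(deriv ^^ j) (\<lambda>x. x * t) x\<bar> \<le> e / 3"
    using smooth_cmult_small[OF smooth_ident e3, of n a b] by blast
  obtain s2 where s2: "s2 > 0" "\<And>t j x. \<bar>t\<bar> \<le> s2 \<Longrightarrow> j \<le> n \<Longrightarrow> x \<in> {a..b} \<Longrightarrow> \<bar>(deriv ^^ j) (\<lambda>x. 1 / (1 + x\<^sup>2) * t) x\<bar> \<le> e / 3"
    using smooth_cmult_small[OF smooth_one_plus_square e3, of n a b] by blast
  obtain q where q: "q \<in> \<rat>" "0 < q" "q < s1" using rat_between_0[OF s1(1)] .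
  obtain c where c: "c \<in> \<rat>" "0 < c" "c < min s2 C" using rat_between_0[of "min s2 C"] s2(1) assms(4) by auto
  \<comment> \<open>The linear coefficient of the sum becomes nonzero, which forces degree at least
    1.\<close>
  define t where "t = (if Polynomial.coeff p 1 = 0 then q else 0)"
  have t: "t \<in> \<rat>" "\<bar>t\<bar> \<le> s1" "Polynomial.coeff p 1 + t \<noteq> 0" using q s1 by (auto simp: t_def)
  let ?T = "p + [:0, t:]"
  have "rat_poly ?T" using p t by (intro rat_poly_add) (simp_all add: rat_poly_pCons_iff, simp add: rat_poly_def)
  moreover have "Polynomial.degree ?T \<ge> 1"
    by (rule le_degree) (use t(3) in simp)
  moreover have "\<bar>(deriv ^^ j) (\<lambda>x. poly ?T x + c / (1 + x\<^sup>2) - u x) x\<bar> \<le> e" if jx: "j \<le> n" "x \<in> {a..b}" for j x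
  proof -
    have sm: "smooth (\<lambda>x. poly p x - u x)" "smooth (\<lambda>x. x * t)" "smooth (\<lambda>x. 1 / (1 + x\<^sup>2) * c)"
      by (intro smooth_diff smooth_poly u smooth_mult smooth_ident smooth_const smooth_one_plus_square)+
    have "(\<lambda>x. poly ?T x + c / (1 + x\<^sup>2) - u x) = (\<lambda>x. ((poly p x - u x) + x * t) + 1 / (1 + x\<^sup>2) * c)"
      by (auto simp: fun_eq_iff)
    then have "(deriv ^^ j) (\<lambda>x. poly ?T x + c / (1 + x\<^sup>2) - u x) x =
      ((deriv ^^ j) (\<lambda>x. poly p x - u x) x + (deriv ^^ j) (\<lambda>x. x * t) x) + (deriv ^^ j) (\<lambda>x. 1 / (1 + x\<^sup>2) * c) x"
      by (simp only: funpow_deriv_add[OF smooth_add[OF sm(1,2)] sm(3)] funpow_deriv_add[OF sm(1,2)])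
    moreover have "\<bar>(deriv ^^ j) (\<lambda>x. poly p x - u x) x\<bar> \<le> e / 3" by (rule p(2)[OF jx])
    moreover have "\<bar>(deriv ^^ j) (\<lambda>x. x * t) x\<bar> \<le> e / 3" by (rule s1(2)[OF t(2) jx])
    moreover have "\<bar>(deriv ^^ j) (\<lambda>x. 1 / (1 + x\<^sup>2) * c) x\<bar> \<le> e / 3"
      by (rule s2(2)[OF _ jx]) (use c in auto)
    ultimately show ?thesis by linarith
  qed
  ultimately show ?thesis using c by (intro exI[of _ ?T] exI[of _ c]) auto
qed

text \<open>The correction is w (T + c / (1 + x^2) - u) with a bump \<open>w\<close> equal to 1 on
  [a, b] and zero outside the margin. The free bound C lets later coefficients be chosen below
  earlier ones.\<close>

lemma local_correction:
  fixes a b \<eta> e C :: real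
  assumes u: "smooth u" and "a < b" "\<eta> > 0" "e > 0" "C > 0"
  shows "\<exists>g T c. smooth g \<and> rat_poly T \<and> Polynomial.degree T \<ge> 1 \<and> c \<in> \<rat> \<and> 0 < c \<and> c < C \<and>
    (\<forall>x. x \<notin> {a - \<eta>..b + \<eta>} \<longrightarrow> g x = 0) \<and>
    (\<forall>x\<in>{a..b}. u x + g x = poly T x + c / (1 + x\<^sup>2)) \<and>
    (\<forall>j\<le>n. \<forall>x. \<bar>(deriv ^^ j) g x\<bar> \<le> e) \<and> (\<forall>j. \<exists>B. \<forall>x. \<bar>(deriv ^^ j) g x\<bar> \<le> B)"
proof -
  obtain w where w: "smooth w" "\<And>x. a \<le> x \<Longrightarrow> x \<le> b \<Longrightarrow> w x = 1" "\<And>x. x \<notin> {a - \<eta>..b + \<eta>} \<Longrightarrow> w x = 0"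
    using smooth_bump_exists[of "a - \<eta>" a b "b + \<eta>"] assms(3) by (metis add_strict_left_mono add_0_right diff_strict_left_mono diff_0_right less_add_same_cancel1 diff_less_eq)
  obtain \<delta> where \<delta>: "\<delta> > 0" "\<And>v j x. smooth v \<Longrightarrow> (\<forall>j\<le>n. \<forall>x\<in>{a - \<eta>..b + \<eta>}. \<bar>(deriv ^^ j) v x\<bar> \<le> \<delta>) \<Longrightarrow>
    j \<le> n \<Longrightarrow> x \<in> {a - \<eta>..b + \<eta>} \<Longrightarrow> \<bar>(deriv ^^ j) (\<lambda>x. w x * v x) x\<bar> \<le> e"
    using smooth_mult_small[OF w(1) assms(4), of n "a - \<eta>" "b + \<eta>"] by blast
  have "a - \<eta> \<le> b + \<eta>" using assms by simp
  from polar_approximation[OF u this \<delta>(1) assms(5), of n] obtain T c where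
    T: "rat_poly T" "Polynomial.degree T \<ge> 1" "c \<in> \<rat>" "0 < c" "c < C" and
    D: "\<forall>j\<le>n. \<forall>x\<in>{a - \<eta>..b + \<eta>}. \<bar>(deriv ^^ j) (\<lambda>x. poly T x + c / (1 + x\<^sup>2) - u x) x\<bar> \<le> \<delta>" by blast
  let ?v = "\<lambda>x. poly T x + c / (1 + x\<^sup>2) - u x"
  have "smooth (\<lambda>x. poly T x + 1 / (1 + x\<^sup>2) * c - u x)"
    by (intro smooth_diff smooth_add smooth_poly u smooth_mult smooth_const smooth_one_plus_square)
  then have sv: "smooth ?v" by simp
  let ?g = "\<lambda>x. w x * ?v x"
  have sg: "smooth ?g" by (intro smooth_mult w(1) sv)
  have off: "(deriv ^^ j) ?g x = 0" if "x \<notin> {a - \<eta>..b + \<eta>}" for j x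
  proof -
    have "eventually (\<lambda>y. y \<in> - {a - \<eta>..b + \<eta>}) (nhds x)"
      using that by (intro eventually_nhds_in_open open_Compl closed_atLeastAtMost) auto
    then have "eventually (\<lambda>y. ?g y = 0) (nhds x)" by eventually_elim (simp add: w(3))
    from higher_deriv_cong_ev[OF this refl] show ?thesis by (simp only: funpow_deriv_const0)
  qed
  have "\<bar>(deriv ^^ j) ?g x\<bar> \<le> e" if "j \<le> n" for j x
  proof (cases "x \<in> {a - \<eta>..b + \<eta>}")
    case True then show ?thesis by (rule \<delta>(2)[OF sv D that])
  next
    case False then show ?thesis using off[OF False] assms(4) by (simp only: abs_zero)
  qed
  moreover have "\<exists>B. \<forall>x. \<bar>(deriv ^^ j) ?g x\<bar> \<le> B" for j
  proof -
    have "bounded ((deriv ^^ j) ?g ` {a - \<eta>..b + \<eta>})"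
      by (intro compact_imp_bounded compact_continuous_image smooth_funpow_continuous_on sg compact_Icc)
    then obtain B where B: "B > 0" "\<forall>x\<in>{a - \<eta>..b + \<eta>}. \<bar>(deriv ^^ j) ?g x\<bar> \<le> B"
      unfolding bounded_pos by (auto simp only: ball_simps real_norm_def)
    have "\<bar>(deriv ^^ j) ?g x\<bar> \<le> B" for x
    proof (cases "x \<in> {a - \<eta>..b + \<eta>}")
      case True with B(2) show ?thesis by blast
    next
      case False show ?thesis using B(1) unfolding off[OF False] by simp
    qed
    then show ?thesis by blast
  qed
  moreover have "\<forall>x. x \<notin> {a - \<eta>..b + \<eta>} \<longrightarrow> ?g x = 0" using w(3) by simp
  moreover have "\<forall>x\<in>{a..b}. u x + ?g x = poly T x + c / (1 + x\<^sup>2)" using w(2) by simp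
  ultimately show ?thesis using sg T by blast
qed

text \<open>Only the earlier intervals must be avoided, so finitely many positive distances are
  involved; the intervals may accumulate, and a margin clear of all others cannot be expected. The
  induction adds one earlier interval at a time.\<close>

lemma disjoint_margin:
  fixes a b :: "nat \<Rightarrow> real" and lo hi :: real
  assumes ab: "\<And>k. lo < a k" "\<And>k. a k < b k" "\<And>k. b k < hi"
    and disj: "\<And>j k. j \<noteq> k \<Longrightarrow> {a j..b j} \<inter> {a k..b k} = {}"
  shows "\<exists>\<eta>>0. lo < a k - \<eta> \<and> b k + \<eta> < hi \<and> (\<forall>j<k. {a j..b j} \<inter> {a k - \<eta>..b k + \<eta>} = {})"
proof -
  have "\<exists>\<eta>>0. lo < a k - \<eta> \<and> b k + \<eta> < hi \<and> (\<forall>j<m. {a j..b j} \<inter> {a k - \<eta>..b k + \<eta>} = {})" if "m \<le> k" for m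
    using that
  proof (induction m)
    case 0
    obtain d where "d > 0" "d < a k - lo" "d < hi - b k"
      using dense[of 0 "min (a k - lo) (hi - b k)"] ab(1)[of k] ab(3)[of k] by auto
    then show ?case by (intro exI[of _ d]) auto
  next
    case (Suc m)
    then obtain \<eta> where \<eta>: "\<eta> > 0" "lo < a k - \<eta>" "b k + \<eta> < hi" "\<And>j. j < m \<Longrightarrow> {a j..b j} \<inter> {a k - \<eta>..b k + \<eta>} = {}"
      by auto
    have "{a m..b m} \<inter> {a k..b k} = {}" using disj[of m k] Suc.prems by simp
    moreover have "max (a m) (a k) \<in> {a m..b m} \<inter> {a k..b k}" if "a k \<le> b m" "a m \<le> b k"
      using that ab(2)[of m] ab(2)[of k] by auto
    ultimately have "b m < a k \<or> b k < a m" by (metis empty_iff not_le)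
    then obtain d where d: "d > 0" "b m < a k - d \<or> b k + d < a m"
    proof
      assume "b m < a k" then show ?thesis using that dense[of 0 "a k - b m"] by fastforce
    next
      assume "b k < a m" then show ?thesis using that dense[of 0 "a m - b k"] by fastforce
    qed
    have "{a j..b j} \<inter> {a k - min \<eta> d..b k + min \<eta> d} = {}" if "j < Suc m" for j
    proof (cases "j = m")
      case True with d show ?thesis by auto
    next
      case False
      then have "{a j..b j} \<inter> {a k - \<eta>..b k + \<eta>} = {}" using \<eta>(4)[of j] that by simp
      moreover have "{a k - min \<eta> d..b k + min \<eta> d} \<subseteq> {a k - \<eta>..b k + \<eta>}" by auto
      ultimately show ?thesis by blast
    qed
    with \<eta> d show ?case by (intro exI[of _ "min \<eta> d"]) auto
  qed
  then show ?thesis by blast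
qed

text \<open>The estimate at stage k covers the orders j <= k + r: the first r orders are controlled
  at every stage, and each fixed order at all but finitely many stages, as a smooth sum
  requires.\<close>

lemma correction_sequence:
  fixes a b \<eta> e :: "nat \<Rightarrow> real"
  assumes "\<And>k. a k < b k" "\<And>k. \<eta> k > 0" "\<And>k. e k > 0" and u0: "smooth u0" and C0: "C0 > (0::real)"
  obtains g T c where "\<And>k. smooth (g k)" "\<And>k. rat_poly (T k)" "\<And>k. Polynomial.degree (T k) \<ge> 1"
    "\<And>k. c k \<in> \<rat>" "\<And>k. 0 < c k" "inj c"
    "\<And>k x. x \<notin> {a k - \<eta> k..b k + \<eta> k} \<Longrightarrow> g k x = 0"
    "\<And>k x. x \<in> {a k..b k} \<Longrightarrow> u0 x + (\<Sum>i<Suc k. g i x) = poly (T k) x + c k / (1 + x\<^sup>2)"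
    "\<And>k j x. j \<le> k + r \<Longrightarrow> \<bar>(deriv ^^ j) (g k) x\<bar> \<le> e k"
    "\<And>k j. \<exists>B. \<forall>x. \<bar>(deriv ^^ j) (g k) x\<bar> \<le> B"
proof -
  define Q where "Q k u C g T c \<longleftrightarrow> smooth g \<and> rat_poly T \<and> Polynomial.degree T \<ge> 1 \<and> c \<in> \<rat> \<and> 0 < c \<and> c < C \<and>
    (\<forall>x. x \<notin> {a k - \<eta> k..b k + \<eta> k} \<longrightarrow> g x = 0) \<and>
    (\<forall>x\<in>{a k..b k}. u x + g x = poly T x + c / (1 + x\<^sup>2)) \<and>
    (\<forall>j\<le>k + r. \<forall>x. \<bar>(deriv ^^ j) g x\<bar> \<le> e k) \<and> (\<forall>j. \<exists>B. \<forall>x. \<bar>(deriv ^^ j) g x\<bar> \<le> B)"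
    for k u g T and C c :: real
  have step: "\<exists>g T c. Q k u C g T c" if "smooth u" "C > 0" for k u C
    unfolding Q_def by (rule local_correction) (use that assms in auto)
  \<comment> \<open>The state is the function built so far paired with the bound for the next
    coefficient. The new bound is the coefficient just chosen, so the coefficients decrease
    strictly.\<close>
  have "\<exists>s. \<forall>k. (smooth (fst (s k)) \<and> snd (s k) > 0 \<and> (k = 0 \<longrightarrow> s k = (u0, C0))) \<and>
    (\<exists>g T. Q k (fst (s k)) (snd (s k)) g T (snd (s (Suc k))) \<and> fst (s (Suc k)) = (\<lambda>x. fst (s k) x + g x))"
  proof (rule dependent_nat_choice)
    show "\<exists>x. smooth (fst x) \<and> 0 < snd x \<and> ((0::nat) = 0 \<longrightarrow> x = (u0, C0))"
      using u0 C0 by (intro exI[of _ "(u0, C0)"]) auto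
    fix x :: "(real \<Rightarrow> real) \<times> real" and k :: nat
    assume x: "smooth (fst x) \<and> 0 < snd x \<and> (k = 0 \<longrightarrow> x = (u0, C0))"
    with step obtain g T c where Q: "Q k (fst x) (snd x) g T c" by blast
    show "\<exists>y. (smooth (fst y) \<and> 0 < snd y \<and> (Suc k = 0 \<longrightarrow> y = (u0, C0))) \<and>
      (\<exists>g T. Q k (fst x) (snd x) g T (snd y) \<and> fst y = (\<lambda>z. fst x z + g z))"
      using Q x by (intro exI[of _ "(\<lambda>z. fst x z + g z, c)"]) (auto simp: Q_def intro: smooth_add)
  qed
  then obtain s where s0: "s 0 = (u0, C0)" and
    "\<forall>k. \<exists>g T. Q k (fst (s k)) (snd (s k)) g T (snd (s (Suc k))) \<and> fst (s (Suc k)) = (\<lambda>x. fst (s k) x + g x)"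
    by blast
  then obtain g T where gT: "\<And>k. Q k (fst (s k)) (snd (s k)) (g k) (T k) (snd (s (Suc k)))"
    "\<And>k. fst (s (Suc k)) = (\<lambda>x. fst (s k) x + g k x)" by metis
  define c where "c k = snd (s (Suc k))" for k
  have sum: "fst (s k) x = u0 x + (\<Sum>i<k. g i x)" for k x
    by (induction k) (auto simp: s0 gT(2))
  have "strict_mono (\<lambda>k. - c k)"
    using gT(1) by (auto simp: strict_mono_Suc_iff c_def Q_def)
  then have "inj (\<lambda>k. - c k)" by (rule strict_mono_imp_inj_on)
  then have inj: "inj c" by (auto simp: inj_on_def)
  show ?thesis
  proof (rule that[of g T c, OF _ _ _ _ _ inj])
    show "u0 x + (\<Sum>i<Suc k. g i x) = poly (T k) x + c k / (1 + x\<^sup>2)" if "x \<in> {a k..b k}" for k x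
    proof -
      have "fst (s k) x + g k x = poly (T k) x + c k / (1 + x\<^sup>2)"
        using gT(1)[of k] that by (simp add: Q_def c_def)
      then show ?thesis by (simp add: sum add.assoc)
    qed
  qed (use gT(1) in \<open>auto simp: Q_def c_def\<close>)
qed

lemma smooth_near_id_bij:
  assumes f: "smooth f" "\<And>x. deriv f x > 0" "\<And>x. \<bar>f x - x\<bar> \<le> 1"
  shows "bij f"
proof -
  have "strict_mono f"
    by (rule strict_monoI, rule DERIV_pos_imp_increasing) (use f(2) smooth_DERIV[OF f(1)] in blast)+
  then have "inj f" by (rule strict_mono_imp_inj_on)
  moreover have "surj f"
  proof -
    have "\<exists>x. f x = y" for y
    proof -
      have "\<exists>x. y - 2 \<le> x \<and> x \<le> y + 2 \<and> f x = y"
        by (rule IVT') (use f(3)[of "y - 2"] f(3)[of "y + 2"] smooth_continuous_on[OF f(1)] in \<open>auto simp: abs_le_iff\<close>)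
      then show ?thesis by blast
    qed
    then show ?thesis by (metis surj_def)
  qed
  ultimately show ?thesis by (simp add: bij_def)
qed

lemma deriv_one_over_one_plus_square_le: "\<bar>deriv (\<lambda>x. 1 / (1 + x\<^sup>2)) x\<bar> \<le> (1::real)"
proof -
  have "((\<lambda>x. 1 / (1 + x\<^sup>2)) has_real_derivative - (2 * x) / (1 + x\<^sup>2)\<^sup>2) (at x)"
    using one_plus_square(2)[of x] by (auto intro!: derivative_eq_intros simp: power2_eq_square)
  then have d: "deriv (\<lambda>x. 1 / (1 + x\<^sup>2)) x = - (2 * x) / (1 + x\<^sup>2)\<^sup>2" by (rule DERIV_imp_deriv)
  have "0 \<le> (\<bar>x\<bar> - 1)\<^sup>2" by simp
  then have "\<bar>2 * x\<bar> \<le> 1 + x\<^sup>2" by (simp add: power2_diff abs_mult)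
  also have "\<dots> \<le> (1 + x\<^sup>2)\<^sup>2" by (rule self_le_power) auto
  finally show ?thesis using one_plus_square(1)[of x] unfolding d by (simp add: abs_divide abs_mult)
qed

section \<open>The diffeomorphism\<close>

lemma exists_locally_polar_diffeomorphism:
  fixes A \<epsilon> :: real
  assumes "\<epsilon> > 0"
  shows "\<exists>f. smooth_diffeomorphism f \<and> orientation_preserving f \<and> transcendental_over_Rx UNIV f \<and>
    (\<forall>x\<in>Liouville_numbers \<union> {x. Polynomial.algebraic x}. locally_polar f x) \<and>
    (\<forall>j\<le>r. \<forall>x\<in>{-A..A}. \<bar>(deriv ^^ j) (\<lambda>x. f x - x) x\<bar> \<le> \<epsilon>)"
proof -
  \<comment> \<open>The cap 1/2 bounds |G'| by 1/4; together with |h'| < 1/2 this keeps f'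
    positive.\<close>
  define d where "d = min \<epsilon> (1/2)"
  have d: "d > 0" "d \<le> \<epsilon>" "d \<le> 1/2" using assms by (auto simp: d_def)
  obtain a b :: "nat \<Rightarrow> real" and lo hi where ab: "\<And>k. lo < a k" "\<And>k. a k < b k" "\<And>k. b k < hi"
    and disj: "\<And>j k. j \<noteq> k \<Longrightarrow> {a j..b j} \<inter> {a k..b k} = {}"
    and cover: "Liouville_numbers \<union> {x. Polynomial.algebraic x} \<subseteq> {..<lo} \<union> {hi<..} \<union> (\<Union>k. {a k<..<b k})"
    by (rule Liouville_algebraic_cover) (rule that)
  have "\<exists>\<eta>>0. lo < a k - \<eta> \<and> b k + \<eta> < hi \<and> (\<forall>j<k. {a j..b j} \<inter> {a k - \<eta>..b k + \<eta>} = {})" for k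
    by (rule disjoint_margin[OF ab disj])
  then obtain \<eta> where \<eta>: "\<And>k. \<eta> k > 0" "\<And>k. lo < a k - \<eta> k" "\<And>k. b k + \<eta> k < hi"
    "\<And>j k. j < k \<Longrightarrow> {a j..b j} \<inter> {a k - \<eta> k..b k + \<eta> k} = {}" by metis
  have "d / 2 > 0" using d by simp
  from smooth_cmult_small[OF smooth_one_plus_square this, of r "-A" A] obtain s where
    s: "s > 0" "\<And>t j x. \<bar>t\<bar> \<le> s \<Longrightarrow> j \<le> r \<Longrightarrow> x \<in> {-A..A} \<Longrightarrow> \<bar>(deriv ^^ j) (\<lambda>x. 1 / (1 + x\<^sup>2) * t) x\<bar> \<le> d / 2"
    by blast
  \<comment> \<open>The bound \<open>s\<close> makes h small up to order r on [-A, A], and the bound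
    1/2 controls h and h' on the whole line.\<close>
  obtain c0 where c0: "c0 \<in> \<rat>" "0 < c0" "c0 < min s (1/2)" using rat_between_0[of "min s (1/2)"] s(1) by auto
  define h where "h x = 1 / (1 + x\<^sup>2) * c0" for x :: real
  have sh: "smooth h" unfolding h_def by (intro smooth_mult smooth_const smooth_one_plus_square)
  define u0 where "u0 x = x + h x" for x
  have su0: "smooth u0" unfolding u0_def by (intro smooth_add smooth_ident sh)
  define e where "e k = d / 2 * (1/2) ^ Suc k" for k :: nat
  have e: "e k > 0" for k using d by (simp add: e_def)
  have "(\<lambda>k. d / 2 * (1/2) ^ Suc k) sums (d / 2 * 1)" by (intro sums_mult power_half_series)
  then have es: "summable e" "suminf e = d / 2" unfolding e_def by (auto simp: sums_iff)
  obtain g T c where g: "\<And>k. smooth (g k)" and T: "\<And>k. rat_poly (T k)" "\<And>k. Polynomial.degree (T k) \<ge> 1"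
    and c: "\<And>k. c k \<in> \<rat>" "\<And>k. 0 < c k" "inj c"
    and off: "\<And>k x. x \<notin> {a k - \<eta> k..b k + \<eta> k} \<Longrightarrow> g k x = 0"
    and on: "\<And>k x. x \<in> {a k..b k} \<Longrightarrow> u0 x + (\<Sum>i<Suc k. g i x) = poly (T k) x + c k / (1 + x\<^sup>2)"
    and small: "\<And>k j x. j \<le> k + Suc r \<Longrightarrow> \<bar>(deriv ^^ j) (g k) x\<bar> \<le> e k"
    and bnd: "\<And>k j. \<exists>B. \<forall>x. \<bar>(deriv ^^ j) (g k) x\<bar> \<le> B"
    \<comment> \<open>Taking \<open>Suc r\<close> instead of r includes the first derivative even
      when r = 0, as positivity of f' needs.\<close>
    using correction_sequence[where a = a and b = b and \<eta> = \<eta> and e = e and ?u0.0 = u0 and ?C0.0 = c0 and r = "Suc r",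
        OF ab(2) \<eta>(1) e su0 c0(2)] by blast
  obtain M where M: "\<And>j k x. \<bar>(deriv ^^ j) (g k) x\<bar> \<le> M j k" using bnd by metis
  \<comment> \<open>For fixed j only finitely many k fall under the second case, so replacing the
    small bound by an arbitrary one there does not affect summability.\<close>
  define B where "B j k = (if j \<le> k + Suc r then e k else M j k)" for j k
  have B1: "summable (B j)" for j
  proof -
    have "eventually (\<lambda>k. B j k = e k) sequentially"
      using eventually_ge_at_top[of j] by eventually_elim (simp add: B_def)
    then show ?thesis using summable_cong[of "B j" e] es(1) by blast
  qed
  have B2: "\<bar>(deriv ^^ j) (g k) x\<bar> \<le> B j k" for j k x using M small by (simp add: B_def)
  define G where "G x = (\<Sum>k. g k x)" for x
  have sG: "smooth G" unfolding G_def by (rule smooth_suminf(1)[OF g B1 B2])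
  have DG: "\<bar>(deriv ^^ j) G x\<bar> \<le> d / 2" if "j \<le> Suc r" for j x
  proof -
    have "(deriv ^^ j) G x = (\<Sum>k. (deriv ^^ j) (g k) x)"
      unfolding G_def by (rule smooth_suminf(2)[OF g B1 B2])
    also have "norm \<dots> \<le> suminf e" by (rule norm_suminf_le[OF _ es(1)]) (use small that in auto)
    finally show ?thesis using es(2) by simp
  qed
  define f where "f x = u0 x + G x" for x
  have sf: "smooth f" unfolding f_def by (intro smooth_add su0 sG)
  have h_le: "0 < h x" "h x \<le> 1/2" for x
  proof -
    show "0 < h x" using one_plus_square(1)[of x] c0(2) by (simp add: h_def)
    have "1 / (1 + x\<^sup>2) \<le> 1" using one_plus_square(1)[of x] by (simp add: divide_le_eq_1)
    then have "h x \<le> 1 * c0" unfolding h_def using c0(2) by (intro mult_right_mono) auto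
    then show "h x \<le> 1/2" using c0(3) by simp
  qed
  have pos: "deriv f x > 0" for x
  proof -
    have "deriv h x = deriv (\<lambda>x. 1 / (1 + x\<^sup>2)) x * c0"
      unfolding h_def by (intro DERIV_imp_deriv DERIV_cmult_right smooth_DERIV smooth_one_plus_square)
    moreover have "\<bar>deriv (\<lambda>x. 1 / (1 + x\<^sup>2)) x * c0\<bar> \<le> 1 * c0"
      unfolding abs_mult using deriv_one_over_one_plus_square_le[of x] c0(2) by (intro mult_mono) auto
    ultimately have "\<bar>deriv h x\<bar> < 1/2" using c0(3) by simp
    moreover have "deriv f x = 1 + deriv h x + deriv G x"
      unfolding f_def u0_def by (intro DERIV_imp_deriv DERIV_add DERIV_ident smooth_DERIV sh sG)
    moreover have "\<bar>deriv G x\<bar> \<le> d / 2" using DG[of 1 x] by simp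
    ultimately show ?thesis using d by linarith
  qed
  have near: "\<bar>f x - x\<bar> \<le> 1" for x
    using DG[of 0 x] h_le[of x] d unfolding f_def u0_def by simp
  have bij: "bij f" by (rule smooth_near_id_bij[OF sf pos near])
  have "smooth_diffeomorphism f"
    unfolding smooth_diffeomorphism_def using bij sf smooth_inv[OF sf bij pos] by blast
  moreover have "orientation_preserving f" using pos by (simp add: orientation_preserving_def)
  moreover have piece: "f x = poly (T k) x + c k / (1 + x\<^sup>2)" if "a k < x" "x < b k" for k x
  proof -
    \<comment> \<open>Later corrections stay clear of the k-th gap, so f is there what stage k
      produced.\<close>
    have "g i x = 0" if "i \<notin> {..<Suc k}" for i
    proof (rule off)
      have "k < i" using that by simp
      from \<eta>(4)[OF this] \<open>a k < x\<close> \<open>x < b k\<close> show "x \<notin> {a i - \<eta> i..b i + \<eta> i}" by auto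
    qed
    then have "G x = (\<Sum>i<Suc k. g i x)" unfolding G_def by (intro suminf_finite) auto
    then show ?thesis using on[of x k] that by (simp add: f_def)
  qed
  have "transcendental_over_Rx UNIV f"
    by (rule infinitely_many_pieces_imp_transcendental[OF ab(2) piece c(3)])
  moreover have "locally_polar f x" if x: "x \<in> Liouville_numbers \<union> {x. Polynomial.algebraic x}" for x
  proof -
    from x cover consider "x \<in> {..<lo} \<union> {hi<..}" | k where "x \<in> {a k<..<b k}" by blast
    then show ?thesis
    proof cases
      case 1
      \<comment> \<open>All corrections live between \<open>lo\<close> and \<open>hi\<close>;
        outside, f is the starting function x + c0 / (1 + x^2).\<close>
      have "eventually (\<lambda>y. y \<in> {..<lo} \<union> {hi<..}) (nhds x)"
        using 1 by (intro eventually_nhds_in_open) auto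
      then have "eventually (\<lambda>y. f y = poly [:0, 1:] y + c0 / (1 + y\<^sup>2)) (nhds x)"
      proof eventually_elim
        case (elim y)
        have "g k y = 0" for k
        proof (rule off)
          show "y \<notin> {a k - \<eta> k..b k + \<eta> k}" using elim \<eta>(2,3)[of k] by auto
        qed
        then show ?case by (simp add: f_def G_def u0_def h_def)
      qed
      moreover have "rat_poly [:0, 1:]" by (simp add: rat_poly_pCons_iff, simp add: rat_poly_def)
      ultimately show ?thesis unfolding locally_polar_def using c0
        by (intro exI[of _ "[:0, 1:]"] exI[of _ c0]) auto
    next
      case 2
      have "eventually (\<lambda>y. y \<in> {a k<..<b k}) (nhds x)"
        using 2 by (intro eventually_nhds_in_open) auto
      then have "eventually (\<lambda>y. f y = poly (T k) y + c k / (1 + y\<^sup>2)) (nhds x)"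
        by eventually_elim (rule piece, auto)
      then show ?thesis unfolding locally_polar_def using T[of k] c(1,2)[of k]
        by (intro exI[of _ "T k"] exI[of _ "c k"]) auto
    qed
  qed
  moreover have "\<bar>(deriv ^^ j) (\<lambda>x. f x - x) x\<bar> \<le> \<epsilon>" if jx: "j \<le> r" "x \<in> {-A..A}" for j x
  proof -
    have "(\<lambda>x. f x - x) = (\<lambda>x. h x + G x)" by (auto simp: f_def u0_def)
    then have "(deriv ^^ j) (\<lambda>x. f x - x) x = (deriv ^^ j) h x + (deriv ^^ j) G x"
      by (simp only: funpow_deriv_add[OF sh sG])
    moreover have "\<bar>(deriv ^^ j) h x\<bar> \<le> d / 2"
      unfolding h_def by (rule s(2)[OF _ jx]) (use c0 in auto)
    moreover have "\<bar>(deriv ^^ j) G x\<bar> \<le> d / 2" by (rule DG) (use jx in simp)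
    ultimately show ?thesis using d by linarith
  qed
  ultimately show ?thesis by blast
qed

section \<open>Neighbourhoods of the identity in the smooth topology\<close>

lemma Cinf_seminorm_close:
  assumes sv: "smooth v" and sw: "smooth w" and su: "smooth u"
    and close: "\<And>j x. j \<le> r \<Longrightarrow> \<bar>x\<bar> \<le> real A \<Longrightarrow> \<bar>(deriv ^^ j) (\<lambda>x. v x - w x) x\<bar> \<le> e"
  shows "Cinf_seminorm A r (\<lambda>x. v x - u x) \<le> Cinf_seminorm A r (\<lambda>x. w x - u x) + e"
proof -
  let ?X = "{x. \<bar>x\<bar> \<le> real A}"
  let ?S = "\<lambda>u j. SUP x\<in>?X. \<bar>(deriv ^^ j) u x\<bar>"
  have X: "?X = {- real A..real A}" by (auto simp: abs_le_iff)
  \<comment> \<open>Compactness makes the supremum of these derivatives a genuine upper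
    bound.\<close>
  have bdd: "bdd_above ((\<lambda>x. \<bar>(deriv ^^ j) (\<lambda>x. w x - u x) x\<bar>) ` ?X)" for j
    unfolding X by (intro bounded_imp_bdd_above compact_imp_bounded compact_continuous_image
        continuous_on_rabs smooth_funpow_continuous_on smooth_diff sw su compact_Icc)
  have "?S (\<lambda>x. v x - u x) j \<le> Cinf_seminorm A r (\<lambda>x. w x - u x) + e" if j: "j \<le> r" for j
  proof (rule cSUP_least)
    show "?X \<noteq> {}" by (auto intro: exI[of _ 0])
    fix x assume x: "x \<in> ?X"
    have "(\<lambda>x. v x - u x) = (\<lambda>x. (v x - w x) + (w x - u x))" by auto
    then have "(deriv ^^ j) (\<lambda>x. v x - u x) x = (deriv ^^ j) (\<lambda>x. v x - w x) x + (deriv ^^ j) (\<lambda>x. w x - u x) x"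
      by (simp only: funpow_deriv_add[OF smooth_diff[OF sv sw] smooth_diff[OF sw su]])
    moreover have "\<bar>(deriv ^^ j) (\<lambda>x. v x - w x) x\<bar> \<le> e" using close[OF j] x by simp
    moreover have "\<bar>(deriv ^^ j) (\<lambda>x. w x - u x) x\<bar> \<le> ?S (\<lambda>x. w x - u x) j"
      by (rule cSUP_upper[OF x bdd])
    moreover have "?S (\<lambda>x. w x - u x) j \<le> Cinf_seminorm A r (\<lambda>x. w x - u x)"
      unfolding Cinf_seminorm_def using j by (intro Max_ge) auto
    ultimately show "\<bar>(deriv ^^ j) (\<lambda>x. v x - u x) x\<bar> \<le> Cinf_seminorm A r (\<lambda>x. w x - u x) + e"
      by linarith
  qed
  then show ?thesis unfolding Cinf_seminorm_def[of A r "\<lambda>x. v x - u x"] by (subst Max_le_iff) auto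
qed

text \<open>Induction over the generation of the topology reduces neighbourhoods of the identity to
  single balls centred there. Finite intersections take the larger A and r and the smaller e; a ball
  with another centre contains a small ball around the identity by the triangle inequality.\<close>

lemma Cinf_neighbourhood_id:
  assumes "openin Cinf_topology V" "id \<in> V"
  shows "\<exists>A::nat. \<exists>r e. e > 0 \<and> (\<forall>v. smooth v \<longrightarrow>
    (\<forall>j\<le>r. \<forall>x\<in>{- real A..real A}. \<bar>(deriv ^^ j) (\<lambda>x. v x - x) x\<bar> \<le> e) \<longrightarrow> v \<in> V)"
proof -
  let ?B = "{{v. smooth v \<and> Cinf_seminorm A r (\<lambda>x. v x - u x) < e} | A r u e. smooth u \<and> e > 0}"
  have "generate_topology_on ?B V"
    using assms(1) by (simp only: Cinf_topology_def openin_topology_generated_by_iff)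
  then show ?thesis using assms(2)
  proof (induction rule: generate_topology_on.induct)
    case (Int V W)
    then obtain A1 r1 e1 A2 r2 e2 where
      V: "e1 > 0" "\<And>v. smooth v \<Longrightarrow> (\<forall>j\<le>r1. \<forall>x\<in>{- real A1..real A1}. \<bar>(deriv ^^ j) (\<lambda>x. v x - x) x\<bar> \<le> e1) \<Longrightarrow> v \<in> V" and
      W: "e2 > 0" "\<And>v. smooth v \<Longrightarrow> (\<forall>j\<le>r2. \<forall>x\<in>{- real A2..real A2}. \<bar>(deriv ^^ j) (\<lambda>x. v x - x) x\<bar> \<le> e2) \<Longrightarrow> v \<in> W"
      by blast
    show ?case
    proof (rule exI[of _ "max A1 A2"], rule exI[of _ "max r1 r2"], rule exI[of _ "min e1 e2"], intro conjI allI impI)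
      show "min e1 e2 > 0" using V W by simp
      fix v assume v: "smooth v" "\<forall>j\<le>max r1 r2. \<forall>x\<in>{- real (max A1 A2)..real (max A1 A2)}.
        \<bar>(deriv ^^ j) (\<lambda>x. v x - x) x\<bar> \<le> min e1 e2"
      have close: "\<bar>(deriv ^^ j) (\<lambda>x. v x - x) x\<bar> \<le> min e1 e2"
        if "j \<le> max r1 r2" "x \<in> {- real (max A1 A2)..real (max A1 A2)}" for j x
        using v(2) that by blast
      have max: "real A1 \<le> real (max A1 A2)" "real A2 \<le> real (max A1 A2)" "r1 \<le> max r1 r2" "r2 \<le> max r1 r2"
        by auto
      have "\<bar>(deriv ^^ j) (\<lambda>x. v x - x) x\<bar> \<le> e1" if "j \<le> r1" "x \<in> {- real A1..real A1}" for j x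
        using close[of j x] that max unfolding atLeastAtMost_iff by linarith
      then have "v \<in> V" using V(2)[OF v(1)] by blast
      moreover have "\<bar>(deriv ^^ j) (\<lambda>x. v x - x) x\<bar> \<le> e2" if "j \<le> r2" "x \<in> {- real A2..real A2}" for j x
        using close[of j x] that max unfolding atLeastAtMost_iff by linarith
      then have "v \<in> W" using W(2)[OF v(1)] by blast
      ultimately show "v \<in> V \<inter> W" by blast
    qed
  next
    case (UN K)
    then obtain V where V: "V \<in> K" "id \<in> V" by blast
    from UN.IH[OF V] V(1) show ?case by blast
  next
    case (Basis V)
    then obtain A r u e where u: "smooth u" and V: "V = {v. smooth v \<and> Cinf_seminorm A r (\<lambda>x. v x - u x) < e}" by blast
    have id: "Cinf_seminorm A r (\<lambda>x. x - u x) < e" using Basis(2) V by simp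
    \<comment> \<open>Half of the slack is used because closeness is a weak inequality while the
      ball is strict.\<close>
    define s where "s = (e - Cinf_seminorm A r (\<lambda>x. x - u x)) / 2"
    have s: "s > 0" "Cinf_seminorm A r (\<lambda>x. x - u x) + s < e" using id by (auto simp: s_def field_simps)
    have "v \<in> V" if v: "smooth v" "\<forall>j\<le>r. \<forall>x\<in>{- real A..real A}. \<bar>(deriv ^^ j) (\<lambda>x. v x - x) x\<bar> \<le> s" for v
    proof -
      have "Cinf_seminorm A r (\<lambda>x. v x - u x) \<le> Cinf_seminorm A r (\<lambda>x. x - u x) + s"
        by (rule Cinf_seminorm_close[OF v(1) smooth_ident u]) (use v(2) in \<open>auto simp: abs_le_iff\<close>)
      with s v(1) show ?thesis by (simp add: V)
    qed
    with s(1) show ?case by blast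
  qed auto
qed

theorem theorem1p1:
  shows "(\<exists>f :: real \<Rightarrow> real.
            smooth_diffeomorphism f \<and> orientation_preserving f \<and> transcendental_over_Rx UNIV f \<and>
            (\<forall>K. real_number_field K \<longrightarrow> (\<forall>n::nat\<ge>1. \<forall>m::nat. (deriv ^^ m) (f ^^ n) ` K \<subseteq> K)) \<and>
            (\<forall>n::nat\<ge>1. \<forall>m::nat.
               (deriv ^^ m) (f ^^ n) ` Liouville_numbers \<subseteq> Liouville_numbers))
       \<and> (\<forall>U. U \<subseteq> topspace Cinf_topology \<and> (\<exists>V. openin Cinf_topology V \<and> id \<in> V \<and> V \<subseteq> U) \<longrightarrow>
            (\<exists>f\<in>U.
               smooth_diffeomorphism f \<and> orientation_preserving f \<and> transcendental_over_Rx UNIV f \<and>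
               (\<forall>K. real_number_field K \<longrightarrow> (\<forall>n::nat\<ge>1. \<forall>m::nat. (deriv ^^ m) (f ^^ n) ` K \<subseteq> K)) \<and>
               (\<forall>n::nat\<ge>1. \<forall>m::nat.
                  (deriv ^^ m) (f ^^ n) ` Liouville_numbers \<subseteq> Liouville_numbers)))"
    (is "Ex ?P \<and> ?N")
proof
  have ex: "\<exists>f. ?P f \<and> smooth f \<and> (\<forall>j\<le>r. \<forall>x\<in>{-A..A}. \<bar>(deriv ^^ j) (\<lambda>x. f x - x) x\<bar> \<le> \<epsilon>)"
    if "\<epsilon> > 0" for r and A \<epsilon> :: real
  proof -
    from exists_locally_polar_diffeomorphism[OF that, of r A] obtain f where
      f: "smooth_diffeomorphism f" "orientation_preserving f" "transcendental_over_Rx UNIV f"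
      "\<forall>j\<le>r. \<forall>x\<in>{-A..A}. \<bar>(deriv ^^ j) (\<lambda>x. f x - x) x\<bar> \<le> \<epsilon>" and
      lp: "\<And>x. x \<in> Liouville_numbers \<union> {x. Polynomial.algebraic x} \<Longrightarrow> locally_polar f x" by blast
    have sf: "smooth f" using f(1) by (simp add: smooth_diffeomorphism_def)
    show ?thesis using f sf locally_polar_imp_invariant[OF sf lp] by blast
  qed
  show "Ex ?P" using ex[of 1 0 0] by auto
  show ?N
  proof (intro allI impI, elim conjE exE)
    fix U V assume V: "openin Cinf_topology V" "id \<in> V" "V \<subseteq> U"
    obtain A r e where e: "e > 0" "\<And>v. smooth v \<Longrightarrow>
      (\<forall>j\<le>r. \<forall>x\<in>{- real A..real A}. \<bar>(deriv ^^ j) (\<lambda>x. v x - x) x\<bar> \<le> e) \<Longrightarrow> v \<in> V"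
      using Cinf_neighbourhood_id[OF V(1,2)] by blast
    obtain f where f: "?P f" "smooth f" "\<forall>j\<le>r. \<forall>x\<in>{- real A..real A}. \<bar>(deriv ^^ j) (\<lambda>x. f x - x) x\<bar> \<le> e"
      using ex[OF e(1), of r "real A"] by blast
    have "f \<in> U" using e(2)[OF f(2,3)] V(3) by blast
    with f(1) show "\<exists>f\<in>U. ?P f" by blast
  qed
qed

end
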